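(* If $T$ is a tree with $k$ edges, then $\pi_k^{\ast}(T) \leq \pi_k^{\ast}(K_{1, k}) = \left(\frac{k-1}{k}\right)^2$, where $K_{1,k}$ is the star with $k$ edges.
   Context: A graph system of order $k$ on a vertex set $V$ is a tuple $\mathcal{G}=(G_1,\dots,G_k)$ of simple graphs on the common vertex set $V$. A graph $H$ with $V(H)\subseteq V$ is a rainbow subgraph of $\mathcal{G}$ if there is an injective map $\psi:E(H)\to[k]$ with $e\in E(G_{\psi(e)})$ for every $e\in E(H)$; $\mathcal{G}$ is rainbow $H$-free if it has no rainbow subgraph isomorphic to $H$. $\mathrm{ex}_k^{\ast}(n,H)$ is the maximum of $\min_{1\le i\le k}|E(G_i)|$ over all rainbow $H$-free graph systems $(G_1,\dots,G_k)$ on $[n]$, and $\pi_k^{\ast}(H)=\lim_{n\to\infty}\mathrm{ex}_k^{\ast}(n,H)/\binom{n}{2}$ (this limit exists). *)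

theory Defs
  imports Complex_Main "HOL-Library.Ramsey"
begin

text \<open>Graphs are given by a vertex set and a set of edges, each edge being a two-element
  set of vertices.\<close>

type_synonym 'a ugraph = "'a set \<times> 'a set set"

abbreviation verts :: "'a ugraph \<Rightarrow> 'a set" where "verts G \<equiv> fst G"
abbreviation edges :: "'a ugraph \<Rightarrow> 'a set set" where "edges G \<equiv> snd G"

definition simple_graph :: "'a ugraph \<Rightarrow> bool" where
  "simple_graph G \<longleftrightarrow> finite (verts G) \<and> edges G \<subseteq> nsets (verts G) 2"

definition graph_iso :: "'a ugraph \<Rightarrow> 'b ugraph \<Rightarrow> bool" where
  "graph_iso G H \<longleftrightarrow> (\<exists>f. bij_betw f (verts G) (verts H) \<and>
     (\<forall>u\<in>verts G. \<forall>v\<in>verts G. {u, v} \<in> edges G \<longleftrightarrow> {f u, f v} \<in> edges H))"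

definition walk :: "'a ugraph \<Rightarrow> 'a list \<Rightarrow> bool" where
  "walk G xs \<longleftrightarrow> xs \<noteq> [] \<and> set xs \<subseteq> verts G \<and> successively (\<lambda>u v. {u, v} \<in> edges G) xs"

definition connected_graph :: "'a ugraph \<Rightarrow> bool" where
  "connected_graph G \<longleftrightarrow> verts G \<noteq> {} \<and>
     (\<forall>u\<in>verts G. \<forall>v\<in>verts G. \<exists>xs. walk G xs \<and> hd xs = u \<and> last xs = v)"

text \<open>A cycle is listed without repeating its starting vertex.\<close>

definition cycle :: "'a ugraph \<Rightarrow> 'a list \<Rightarrow> bool" where
  "cycle G xs \<longleftrightarrow> walk G xs \<and> distinct xs \<and> length xs \<ge> 3 \<and> {last xs, hd xs} \<in> edges G"

definition tree :: "'a ugraph \<Rightarrow> bool" where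
  "tree T \<longleftrightarrow> simple_graph T \<and> connected_graph T \<and> (\<nexists>xs. cycle T xs)"

text \<open>The star \<open>K\<^sub>1\<^sub>,\<^sub>k\<close> with centre \<open>0\<close> and leaves \<open>1, \<dots>, k\<close>.\<close>

definition star_graph :: "nat \<Rightarrow> nat ugraph" where
  "star_graph k = ({0..k}, {{0, i} | i. i \<in> {1..k}})"

text \<open>A graph system of order \<open>k\<close> is a family indexed by \<open>{1..k}\<close>; its values at other
  indices are irrelevant.\<close>

definition graph_system :: "nat \<Rightarrow> 'a set \<Rightarrow> (nat \<Rightarrow> 'a ugraph) \<Rightarrow> bool" where
  "graph_system k V G \<longleftrightarrow> (\<forall>i\<in>{1..k}. simple_graph (G i) \<and> verts (G i) = V)"

definition rainbow_subgraph ::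
    "nat \<Rightarrow> 'a set \<Rightarrow> (nat \<Rightarrow> 'a ugraph) \<Rightarrow> 'a ugraph \<Rightarrow> bool" where
  "rainbow_subgraph k V G H \<longleftrightarrow> simple_graph H \<and> verts H \<subseteq> V \<and>
     (\<exists>\<psi>. inj_on \<psi> (edges H) \<and> \<psi> ` edges H \<subseteq> {1..k} \<and>
        (\<forall>e\<in>edges H. e \<in> edges (G (\<psi> e))))"

definition rainbow_free ::
    "nat \<Rightarrow> 'a set \<Rightarrow> (nat \<Rightarrow> 'a ugraph) \<Rightarrow> 'b ugraph \<Rightarrow> bool" where
  "rainbow_free k V G H \<longleftrightarrow> (\<nexists>H'. rainbow_subgraph k V G H' \<and> graph_iso H' H)"

text \<open>Meaningful for \<open>k \<ge> 1\<close> and \<open>H\<close> with at least one edge: the inner minimum is then over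
  a nonempty set, and the outer maximum over a finite set which is nonempty because the system
  of edgeless graphs is rainbow \<open>H\<close>-free.\<close>

definition ex_star :: "nat \<Rightarrow> nat \<Rightarrow> 'a ugraph \<Rightarrow> nat" where
  "ex_star k n H = Max {Min ((\<lambda>i. card (edges (G i))) ` {1..k}) | G.
     graph_system k {1..n} G \<and> rainbow_free k {1..n} G H}"

definition pi_star :: "nat \<Rightarrow> 'a ugraph \<Rightarrow> real" where
  "pi_star k H = lim (\<lambda>n. real (ex_star k n H) / real (n choose 2))"

end

theory Submission
  imports Defs
begin

text \<open>
  For vertex weights \<open>p\<close> write \<open>w\<^sub>i(p)\<close> for the value of the quadratic form of the adjacency matrix of \<open>G\<^sub>i\<close>
  at \<open>p\<close>. After deleting \<open>O(n)\<close> edges, every rooted tree \<open>t\<close> and every colour set \<open>S\<close> of size \<open>e(t)\<close> satisfy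
  \<open>\<Sum>i\<in>S. sqrt w\<^sub>i(p) \<le> |S| p(V) - p(B)\<close> for all \<open>p \<ge> 0\<close>, where \<open>B\<close> is the set of vertices that are not the
  root of a rainbow copy of \<open>t\<close> with colour set \<open>S\<close>. If there is no rainbow copy at all, then \<open>B = V\<close>, and
  \<open>p = 1\<close> gives \<open>\<Sum>i. sqrt (2 e(G\<^sub>i)) \<le> (k - 1) n + o(n)\<close>, which bounds the smallest \<open>e(G\<^sub>i)\<close>.

  The inequality is proved by induction on \<open>t\<close>. Gluing two trees at the root is a union bound. When a new
  root is attached to the root of a tree \<open>s\<close>, rescale \<open>p\<close> on \<open>B\<close> so that the inequality is as tight as
  possible; stationarity then gives the weighted average over \<open>B\<close> of the colour degrees, whereas the
  inequalities for \<open>s\<close> and the sets \<open>S - {i}\<close> show that this average is smaller. For the star the bound is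
  attained when \<open>V\<close> is split into \<open>k\<close> almost equal parts and \<open>G\<^sub>i\<close> is complete outside part \<open>i\<close>. The limit
  exists because a suitable subset of \<open>n\<close> vertices inherits all \<open>k\<close> densities up to \<open>O(n\<^sup>-\<^sup>1\<^sup>/\<^sup>2)\<close>.
\<close>

section \<open>A weighted inequality for attaching a root\<close>

text \<open>The analytic core of \<open>planted_bound\<close> below: there \<open>r i\<close> is the square root of the weight of
  colour \<open>i\<close>, \<open>a i\<close> and \<open>e i\<close> are its weights inside \<open>B\<close> and between \<open>B\<close> and its complement, \<open>\<beta>\<close> is the
  weight of \<open>B\<close>, and the left-hand side is the derivative of the sum of the \<open>r i\<close> along \<open>B\<close>.\<close>

lemma stationary_sum_le:
  fixes a e r x z :: "'i \<Rightarrow> real" and \<beta> \<tau> :: real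
  assumes S: "finite S" "card S \<ge> 3"
    and b: "0 < \<beta>" "\<beta> < 1" "1 - \<beta> \<le> \<tau>"
    and a: "\<And>i. i \<in> S \<Longrightarrow> a i \<le> (x i)\<^sup>2"
    and e: "\<And>i. i \<in> S \<Longrightarrow> e i \<le> \<beta> * z i" "\<And>i. i \<in> S \<Longrightarrow> a i + 2 * e i \<le> (r i)\<^sup>2"
    and x: "\<And>i. i \<in> S \<Longrightarrow> 0 \<le> x i" "\<And>i. i \<in> S \<Longrightarrow> x i \<le> \<beta>"
    and z: "\<And>i. i \<in> S \<Longrightarrow> 0 \<le> z i" "\<And>i. i \<in> S \<Longrightarrow> z i \<le> 1 - \<beta>"
    and r: "\<And>i. i \<in> S \<Longrightarrow> r i \<le> 1" "\<And>i. i \<in> S \<Longrightarrow> x i + z i \<le> r i - \<tau>"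
    and sum_r: "(\<Sum>i\<in>S. r i) = real (card S) - 1 + \<tau>"
  shows "(\<Sum>i\<in>S. (a i + e i) / r i) \<le> (real (card S) - 1) * \<beta>"
proof -
  define k where "k = real (card S)"
  define u where "u i = r i - \<tau>" for i
  have k3: "k \<ge> 3" using S by (simp add: k_def)
  have \<tau>: "\<tau> > 0" using b by simp
  have u: "0 \<le> u i" "x i + z i \<le> u i" "x i \<le> u i" "r i = u i + \<tau>" "0 < r i" if "i \<in> S" for i
    using x(1)[OF that] z(1)[OF that] r(2)[OF that] \<tau> by (auto simp: u_def)
  have sum_u: "(\<Sum>i\<in>S. u i) = (k - 1) * (1 - \<tau>)"
    using sum_r by (simp add: u_def sum_subtractf k_def algebra_simps)
  have sum_r': "(\<Sum>i\<in>S. r i) = k - 1 + \<tau>" using sum_r by (simp add: k_def)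
  show ?thesis
  proof (cases "1 \<le> \<tau> * (k + 1)")
    case True
    \<comment> \<open>Here \<open>a i + e i \<le> \<beta> * u i\<close> suffices; \<open>1 / r i\<close> is bounded below by its tangent at the mean \<open>1 / l\<close>.\<close>
    define l where "l = k / (k - 1 + \<tau>)"
    have pos: "k - 1 + \<tau> > 0" using k3 \<tau> by simp
    have bd: "(a i + e i) / r i \<le> \<beta> * (1 - \<tau> * (2 * l - l\<^sup>2 * r i))" if i: "i \<in> S" for i
    proof -
      have "a i + e i \<le> x i * x i + \<beta> * z i" using a[OF i] e(1)[OF i] by (simp add: power2_eq_square)
      also have "\<dots> \<le> \<beta> * x i + \<beta> * z i"
        using x[OF i] by (simp add: mult_right_mono)
      also have "\<dots> \<le> \<beta> * u i" using u(2)[OF i] b by (simp flip: distrib_left)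
      finally have "(a i + e i) / r i \<le> \<beta> * u i / r i" using u(5)[OF i] by (simp add: divide_right_mono)
      also have "\<dots> = \<beta> * (1 - \<tau> * (1 / r i))" using u(4,5)[OF i] by (simp add: field_simps)
      also have "\<dots> \<le> \<beta> * (1 - \<tau> * (2 * l - l\<^sup>2 * r i))"
      proof -
        have "0 \<le> (1 - l * r i)\<^sup>2 / r i" using u(5)[OF i] by simp
        also have "\<dots> = 1 / r i - (2 * l - l\<^sup>2 * r i)"
          using u(5)[OF i] by (simp add: field_simps power2_eq_square)
        finally have "2 * l - l\<^sup>2 * r i \<le> 1 / r i" by simp
        then have "\<tau> * (2 * l - l\<^sup>2 * r i) \<le> \<tau> * (1 / r i)" using \<tau> by (intro mult_left_mono) auto
        then show ?thesis using b by (intro mult_left_mono) auto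
      qed
      finally show ?thesis .
    qed
    have "(\<Sum>i\<in>S. (a i + e i) / r i) \<le> (\<Sum>i\<in>S. \<beta> * (1 - \<tau> * (2 * l - l\<^sup>2 * r i)))"
      by (intro sum_mono bd)
    also have "\<dots> = \<beta> * (k - \<tau> * (2 * l * k - l\<^sup>2 * (k - 1 + \<tau>)))"
      unfolding sum_r'[symmetric] by (simp add: k_def sum_subtractf flip: sum_distrib_left)
    also have "2 * l * k - l\<^sup>2 * (k - 1 + \<tau>) = k\<^sup>2 / (k - 1 + \<tau>)"
    proof -
      have "l * (k - 1 + \<tau>) = k" using pos by (simp add: l_def)
      then have "l\<^sup>2 * (k - 1 + \<tau>) = l * k" by (simp add: power2_eq_square mult.assoc)
      then show ?thesis by (simp add: l_def power2_eq_square)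
    qed
    also have "\<beta> * (k - \<tau> * (k\<^sup>2 / (k - 1 + \<tau>))) \<le> \<beta> * (k - 1)"
    proof -
      \<comment> \<open>The difference \<open>\<tau> * k^2 - (k - 1 + \<tau>)\<close> factors as
        \<open>(k - 1) * (\<tau> * (k + 1) - 1)\<close>, which is where the threshold of the case
        distinction comes from.\<close>
      have "(k - 1) * (\<tau> * (k + 1) - 1) \<ge> 0" using True k3 by simp
      then have "k - 1 + \<tau> \<le> \<tau> * k\<^sup>2" by (simp add: algebra_simps power2_eq_square)
      then have "1 \<le> \<tau> * (k\<^sup>2 / (k - 1 + \<tau>))" using pos by (simp add: field_simps)
      then show ?thesis using b by (intro mult_left_mono) auto
    qed
    finally show ?thesis by (simp add: k_def mult.commute)
  next
    case False
    have half_le: "B / 2 \<le> A" if "2 * A - B = C" "C \<ge> 0" for A B C :: real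
      using that by linarith
    have t4: "\<tau> < 1/4"
    proof (rule ccontr)
      assume "\<not> ?thesis"
      then have "\<tau> * (k + 1) \<ge> (1/4) * 4" using k3 by (intro mult_mono) auto
      then show False using False by simp
    qed
    \<comment> \<open>Now \<tau> is small, and each colour is compared with \<open>u i\<close>;
      these sum to at most \<open>(k - 1) * \<beta>\<close>. A colour with
      \<open>u i \<ge> 1/2\<close> falls short by \<open>2/3 * \<tau>\<close>, because
      \<open>(x i)^2 + \<beta> * z i\<close> with \<open>x i + z i \<le> u i\<close> is then at most
      \<open>(u i)^2\<close>. For a small one, \<open>a i + e i\<close> is the mean of
      \<open>a i\<close> and \<open>a i + 2 * e i\<close>, which may overshoot a little. The large
      colours pay for all small ones.\<close>
    define L where "L = {i\<in>S. u i \<ge> 1/2}"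
    define M where "M = {i\<in>S. u i < 1/2}"
    have LM: "S = L \<union> M" "L \<inter> M = {}" "finite L" "finite M" using S by (auto simp: L_def M_def)
    have cLM: "k = real (card L) + real (card M)"
      using LM by (simp add: k_def card_Un_disjoint)
    have bL: "(a i + e i) / r i \<le> u i - \<tau> * (2/3)" if "i \<in> L" for i
    proof -
      have i: "i \<in> S" "u i \<ge> 1/2" using that by (auto simp: L_def)
      have "a i + e i \<le> (x i)\<^sup>2 + \<beta> * z i" using a[OF i(1)] e(1)[OF i(1)] by simp
      also have "(x i)\<^sup>2 \<le> (u i - z i)\<^sup>2" using x(1)[OF i(1)] u(2)[OF i(1)] by (intro power_mono) auto
      also have "(u i - z i)\<^sup>2 + \<beta> * z i = (u i)\<^sup>2 - z i * (2 * u i - z i - \<beta>)"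
        by (simp add: power2_eq_square algebra_simps)
      also have "\<dots> \<le> (u i)\<^sup>2" using z[OF i(1)] i by simp
      finally have "(a i + e i) / r i \<le> (u i)\<^sup>2 / r i" using u(5)[OF i(1)] by (simp add: divide_right_mono)
      also have "\<dots> \<le> u i - \<tau> * (2/3)"
      proof -
        have "(u i - \<tau> * (2/3)) * (u i + \<tau>) = (u i)\<^sup>2 + \<tau> * (u i / 3 - 2/3 * \<tau>)"
          by (simp add: power2_eq_square field_simps)
        also have "\<dots> \<ge> (u i)\<^sup>2" using i t4 \<tau> by simp
        finally show ?thesis using u(4,5)[OF i(1)] by (simp add: field_simps)
      qed
      finally show ?thesis .
    qed
    have bM: "(a i + e i) / r i \<le> u i + \<tau> * (1/2 - 2/3 * u i)" if "i \<in> M" for i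
    proof -
      have i: "i \<in> S" "u i < 1/2" using that by (auto simp: M_def)
      have "a i \<le> (u i)\<^sup>2"
        using a[OF i(1)] power_mono[OF u(3)[OF i(1)] x(1)[OF i(1)], of 2] by simp
      then have "a i + e i \<le> ((r i)\<^sup>2 + (u i)\<^sup>2) / 2" using e(2)[OF i(1)] by simp
      then have "(a i + e i) / r i \<le> ((r i)\<^sup>2 + (u i)\<^sup>2) / 2 / r i"
        using u(5)[OF i(1)] by (intro divide_right_mono) auto
      also have "\<dots> \<le> u i + \<tau> * (1/2 - 2/3 * u i)"
      proof -
        have "2 * ((u i + \<tau> * (1/2 - 2/3 * u i)) * (u i + \<tau>)) - ((u i + \<tau>)\<^sup>2 + (u i)\<^sup>2)
          = \<tau> * u i * (1 - 4/3 * u i - 4/3 * \<tau>)"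
          by (simp add: power2_eq_square field_simps)
        moreover have "\<tau> * u i * (1 - 4/3 * u i - 4/3 * \<tau>) \<ge> 0"
          using i t4 \<tau> u(1)[OF i(1)] by (intro mult_nonneg_nonneg) auto
        ultimately have "((u i + \<tau>)\<^sup>2 + (u i)\<^sup>2) / 2 \<le> (u i + \<tau> * (1/2 - 2/3 * u i)) * (u i + \<tau>)"
          using half_le[of "(u i + \<tau> * (1/2 - 2/3 * u i)) * (u i + \<tau>)"] by metis
        then show ?thesis using u(4,5)[OF i(1)] by (simp only: pos_divide_le_eq)
      qed
      finally show ?thesis .
    qed
    have "(\<Sum>i\<in>S. (a i + e i) / r i) = (\<Sum>i\<in>L. (a i + e i) / r i) + (\<Sum>i\<in>M. (a i + e i) / r i)"
      using LM by (simp add: sum.union_disjoint)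
    also have "\<dots> \<le> (\<Sum>i\<in>L. u i - \<tau> * (2/3)) + (\<Sum>i\<in>M. u i + \<tau> * (1/2 - 2/3 * u i))"
      by (intro add_mono sum_mono bL bM)
    also have "\<dots> = (\<Sum>i\<in>S. u i) - \<tau> * (2/3 * real (card L) - (real (card M) / 2 - 2/3 * (\<Sum>i\<in>M. u i)))"
    proof -
      have "(\<Sum>i\<in>S. u i) = (\<Sum>i\<in>L. u i) + (\<Sum>i\<in>M. u i)"
        using LM by (simp add: sum.union_disjoint)
      moreover have "(\<Sum>i\<in>M. u i + \<tau> * (1/2 - 2/3 * u i))
          = (\<Sum>i\<in>M. u i) + \<tau> * (real (card M) / 2 - 2/3 * (\<Sum>i\<in>M. u i))"
        by (simp add: sum_subtractf sum.distrib flip: sum_distrib_left sum_divide_distrib)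
      moreover have "(\<Sum>i\<in>L. u i - \<tau> * (2/3)) = (\<Sum>i\<in>L. u i) - \<tau> * (2/3 * real (card L))"
        by (simp add: sum_subtractf)
      ultimately show ?thesis by (simp add: right_diff_distrib)
    qed
    also have "\<dots> \<le> (\<Sum>i\<in>S. u i)"
    proof -
      have sLM: "(k - 1) * (1 - \<tau>) = (\<Sum>i\<in>L. u i) + (\<Sum>i\<in>M. u i)"
        using LM sum_u by (simp add: sum.union_disjoint)
      have "(\<Sum>i\<in>L. u i) \<le> real (card L) * (1 - \<tau>)"
        using r(1) by (intro sum_bounded_above) (auto simp: u_def L_def)
      then have uM: "(real (card M) - 1) * (1 - \<tau>) \<le> (\<Sum>i\<in>M. u i)"
        using sLM cLM by (simp add: algebra_simps)
      \<comment> \<open>If \<open>L\<close> were empty, the \<open>u i\<close> would sum to at most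
        \<open>k / 2 \<le> 3/4 * (k - 1)\<close>, by \<open>k \<ge> 3\<close>, but their sum
        \<open>(k - 1) * (1 - \<tau>)\<close> is larger than that.\<close>
      have L1: "card L \<ge> 1"
      proof (rule ccontr)
        assume "\<not> ?thesis"
        then have L0: "L = {}" using LM by (simp add: card_eq_0_iff Suc_le_eq)
        have "(\<Sum>i\<in>M. u i) \<le> real (card M) * (1/2)"
          by (intro sum_bounded_above) (auto simp: M_def)
        moreover have "(k - 1) * (3/4) < (k - 1) * (1 - \<tau>)" using t4 k3 by (intro mult_strict_left_mono) auto
        ultimately show False using sLM L0 cLM k3 by simp
      qed
      \<comment> \<open>Since \<open>2/3 * 3/4 = 1/2\<close>, the slope \<open>2/3\<close> makes the
        terms in \<open>card M\<close> cancel, leaving \<open>1/2\<close> when \<open>M\<close> is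
        nonempty.\<close>
      have "real (card M) / 2 - 2/3 * (\<Sum>i\<in>M. u i) \<le> 2/3"
      proof (cases "card M = 0")
        case False
        then have "(real (card M) - 1) * (3/4) \<le> (real (card M) - 1) * (1 - \<tau>)"
          using t4 by (intro mult_left_mono) auto
        then show ?thesis using uM by simp
      next
        case True then show ?thesis using LM by simp
      qed
      then show ?thesis using L1 \<tau> by simp
    qed
    also have "\<dots> \<le> (k - 1) * \<beta>" unfolding sum_u using b k3 by (intro mult_left_mono) auto
    finally show ?thesis by (simp add: k_def)
  qed
qed

text \<open>\<open>R i\<close> is the weight of colour \<open>i\<close> as a function of the share
  \<theta> of \<open>B\<close>, and \<open>G\<close> measures the violation of the wanted bound.
  Compactness gives a maximum; the final equation is the vanishing of the derivative, multiplied by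
  \<open>\<theta> * (1 - \<theta>)\<close>. A positive maximal violation thus pushes the sum above
  \<open>\<theta> * (k - 1)\<close>, the opposite of what \<open>stationary_sum_le\<close>
  asserts.\<close>

lemma block_scaling_max:
  fixes a e c :: "'i \<Rightarrow> real" and S :: "'i set" and k :: real
  defines "R \<equiv> \<lambda>i \<theta>. a i * \<theta>\<^sup>2 + 2 * e i * (\<theta> * (1 - \<theta>)) + c i * (1 - \<theta>)\<^sup>2"
  defines "G \<equiv> \<lambda>\<theta>. (\<Sum>i\<in>S. sqrt (R i \<theta>)) + \<theta> - k"
  assumes "0 \<le> \<theta>0" "\<theta>0 \<le> 1"
  obtains \<theta> where "0 \<le> \<theta>" "\<theta> \<le> 1" "G \<theta>0 \<le> G \<theta>"
    "0 < \<theta> \<and> \<theta> < 1 \<and> (\<forall>i\<in>S. R i \<theta> > 0) \<longrightarrow>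
       (\<Sum>i\<in>S. (a i * \<theta>\<^sup>2 + e i * (\<theta> * (1 - \<theta>))) / sqrt (R i \<theta>)) = \<theta> * (k - 1 + G \<theta>)"
proof -
  have cont: "isCont G \<theta>" for \<theta>
    unfolding G_def R_def by (intro continuous_intros)
  obtain \<theta> where \<theta>: "0 \<le> \<theta>" "\<theta> \<le> 1" "\<And>t. 0 \<le> t \<Longrightarrow> t \<le> 1 \<Longrightarrow> G t \<le> G \<theta>"
    using isCont_eq_Ub[of 0 1 G] cont by auto
  have "(\<Sum>i\<in>S. (a i * \<theta>\<^sup>2 + e i * (\<theta> * (1 - \<theta>))) / sqrt (R i \<theta>)) = \<theta> * (k - 1 + G \<theta>)"
    if t: "0 < \<theta>" "\<theta> < 1" and pos: "\<And>i. i \<in> S \<Longrightarrow> R i \<theta> > 0"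
  proof -
    define D where "D i = (a i * \<theta> + e i * (1 - 2 * \<theta>) - c i * (1 - \<theta>)) / sqrt (R i \<theta>)" for i
    have dR: "((\<lambda>t. sqrt (R i t)) has_real_derivative D i) (at \<theta>)" if "i \<in> S" for i
      unfolding D_def using pos[OF that] unfolding R_def
      by (auto intro!: derivative_eq_intros simp: field_simps power2_eq_square)
    have "(G has_real_derivative (\<Sum>i\<in>S. D i) + 1 - 0) (at \<theta>)"
      unfolding G_def by (intro DERIV_diff DERIV_add DERIV_sum dR DERIV_ident DERIV_const)
    moreover have "\<forall>y. \<bar>\<theta> - y\<bar> < min \<theta> (1 - \<theta>) \<longrightarrow> G y \<le> G \<theta>"
      using \<theta>(3) by (auto simp: abs_if split: if_splits)
    ultimately have D0: "(\<Sum>i\<in>S. D i) + 1 - 0 = 0"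
      using t by (intro DERIV_local_max[of G _ \<theta> "min \<theta> (1 - \<theta>)"]) auto
    have "(a i * \<theta>\<^sup>2 + e i * (\<theta> * (1 - \<theta>))) / sqrt (R i \<theta>) = \<theta> * (1 - \<theta>) * D i + \<theta> * sqrt (R i \<theta>)"
      if "i \<in> S" for i
    proof -
      have s: "sqrt (R i \<theta>) > 0" "sqrt (R i \<theta>) * sqrt (R i \<theta>) = R i \<theta>"
        using pos[OF that] by simp_all
      have "a i * \<theta>\<^sup>2 + e i * (\<theta> * (1 - \<theta>))
          = \<theta> * (1 - \<theta>) * (a i * \<theta> + e i * (1 - 2 * \<theta>) - c i * (1 - \<theta>)) + \<theta> * R i \<theta>"
        by (simp add: R_def power2_eq_square algebra_simps)
      also have "\<dots> = (\<theta> * (1 - \<theta>) * D i + \<theta> * sqrt (R i \<theta>)) * sqrt (R i \<theta>)"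
        using s(1) by (simp add: D_def distrib_right mult.assoc s(2))
      finally show ?thesis using s(1) by (metis nonzero_mult_div_cancel_right less_irrefl)
    qed
    then have "(\<Sum>i\<in>S. (a i * \<theta>\<^sup>2 + e i * (\<theta> * (1 - \<theta>))) / sqrt (R i \<theta>))
        = \<theta> * (1 - \<theta>) * (\<Sum>i\<in>S. D i) + \<theta> * (\<Sum>i\<in>S. sqrt (R i \<theta>))"
      by (simp add: sum.distrib sum_distrib_left)
    also have "(\<Sum>i\<in>S. D i) = -1" using D0 by simp
    finally show ?thesis by (simp add: G_def algebra_simps)
  qed
  with \<theta> assms show ?thesis by (intro that[of \<theta>]) auto
qed

section \<open>Quadratic forms with vertex weights\<close>

definition block :: "('v \<Rightarrow> 'v \<Rightarrow> real) \<Rightarrow> ('v \<Rightarrow> real) \<Rightarrow> 'v set \<Rightarrow> 'v set \<Rightarrow> real" where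
  "block A p X Y = (\<Sum>x\<in>X. \<Sum>y\<in>Y. A x y * (p x * p y))"

lemma block_nonneg:
  "(\<And>x y. 0 \<le> A x y) \<Longrightarrow> (\<And>x. 0 \<le> p x) \<Longrightarrow> 0 \<le> block A p X Y"
  by (auto simp: block_def intro!: sum_nonneg)

lemma block_commute:
  assumes "\<And>x y. A x y = A y x"
  shows "block A p X Y = block A p Y X"
  unfolding block_def using assms by (subst sum.swap) (simp add: mult.commute)

lemma block_split:
  assumes "finite V" "B \<subseteq> V" "\<And>x y. A x y = A y x"
  shows "block A p V V = block A p B B + 2 * block A p B (V - B) + block A p (V - B) (V - B)"
proof -
  have 1: "sum g V = sum g B + sum g (V - B)" for g :: "'a \<Rightarrow> real"
    using assms(1,2) by (metis add.commute sum.subset_diff)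
  have "block A p V V = block A p B B + block A p B (V - B) + (block A p (V - B) B + block A p (V - B) (V - B))"
    by (simp add: block_def 1 sum.distrib)
  then show ?thesis using block_commute[of A p "V - B" B] assms(3) by simp
qed

text \<open>A rank-one majorant factors the double sum. With \<open>f = g\<close> it turns a
  condition on single edges into a linear bound on \<open>sqrt (block A p V V)\<close>, as in
  \<open>bound_two\<close>.\<close>

lemma block_le:
  assumes "finite X" "finite Y" "\<And>x. 0 \<le> p x" "\<And>x. 0 \<le> f x" "\<And>y. 0 \<le> g y"
    and "\<And>x y. x \<in> X \<Longrightarrow> y \<in> Y \<Longrightarrow> A x y \<le> f x * g y"
  shows "block A p X Y \<le> (\<Sum>x\<in>X. f x * p x) * (\<Sum>y\<in>Y. g y * p y)"
proof -
  have "block A p X Y \<le> (\<Sum>x\<in>X. \<Sum>y\<in>Y. (f x * g y) * (p x * p y))"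
    unfolding block_def using assms by (intro sum_mono mult_right_mono) auto
  also have "\<dots> = (\<Sum>x\<in>X. f x * p x) * (\<Sum>y\<in>Y. g y * p y)"
    by (simp add: sum_product algebra_simps)
  finally show ?thesis .
qed

lemma block_le_sum:
  assumes "finite X" "finite Y" "\<And>x. 0 \<le> p x" "\<And>x y. A x y \<le> 1"
    and "\<And>x y. x \<in> X \<Longrightarrow> y \<in> Y \<Longrightarrow> x \<notin> X' \<or> y \<notin> Y' \<Longrightarrow> A x y = 0"
  shows "block A p X Y \<le> sum p (X \<inter> X') * sum p (Y \<inter> Y')"
proof -
  have "block A p X Y \<le> (\<Sum>x\<in>X. of_bool (x \<in> X') * p x) * (\<Sum>y\<in>Y. of_bool (y \<in> Y') * p y)"
  proof (rule block_le)
    fix x y assume "x \<in> X" "y \<in> Y"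
    then show "A x y \<le> of_bool (x \<in> X') * of_bool (y \<in> Y')"
      using assms(4)[of x y] assms(5)[of x y] by auto
  qed (use assms in auto)
  also have "\<dots> = sum p (X \<inter> X') * sum p (Y \<inter> Y')"
    using assms(1,2) by (simp add: sum.inter_restrict of_bool_def if_distrib[of "\<lambda>c. c * _"] cong: if_cong)
  finally show ?thesis .
qed

lemma sqrt_le_of_le_mult: "a \<le> b * b \<Longrightarrow> 0 \<le> b \<Longrightarrow> sqrt a \<le> (b::real)"
  by (simp add: power2_eq_square real_le_lsqrt)

text \<open>Here \<open>B\<close> consists of the vertices that are not the root of a tree obtained by attaching a new root
  to the root of a tree \<open>s\<close>, with colour set \<open>S\<close>; \<open>b i\<close> is the corresponding set for \<open>s\<close> and \<open>S - {i}\<close>. An edge of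
  colour \<open>i\<close> from \<open>B\<close> must end in \<open>b i\<close>, which is \<open>sep\<close>.\<close>

locale planted =
  fixes V B :: "'v set" and S :: "'i set" and A :: "'i \<Rightarrow> 'v \<Rightarrow> 'v \<Rightarrow> real" and b :: "'i \<Rightarrow> 'v set"
  assumes finV: "finite V" and finS: "finite S" and BV: "B \<subseteq> V"
    and A0: "\<And>i x y. 0 \<le> A i x y" and A1: "\<And>i x y. A i x y \<le> 1"
    and A_sym: "\<And>i x y. A i x y = A i y x"
    and sep: "\<And>i x y. i \<in> S \<Longrightarrow> x \<in> B \<Longrightarrow> y \<in> V \<Longrightarrow> y \<notin> b i \<Longrightarrow> A i x y = 0"
    and IH: "\<And>p i. (\<And>x. 0 \<le> p x) \<Longrightarrow> i \<in> S \<Longrightarrow>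
      (\<Sum>j\<in>S - {i}. sqrt (block (A j) p V V)) \<le> (real (card S) - 1) * sum p V - sum p (V \<inter> b i)"
begin

lemma finB: "finite B" "finite (V - B)"
  using finV BV finite_subset by auto

lemma split_sum: "sum p V = sum p B + sum p (V - B)" for p :: "'v \<Rightarrow> real"
  using finV BV by (metis add.commute sum.subset_diff)

lemma split_block: "block (A i) p V V
    = block (A i) p B B + 2 * block (A i) p B (V - B) + block (A i) p (V - B) (V - B)"
  by (rule block_split[OF finV BV A_sym])

lemma sep': "i \<in> S \<Longrightarrow> x \<in> V \<Longrightarrow> x \<notin> b i \<Longrightarrow> y \<in> B \<Longrightarrow> A i x y = 0"
  using sep A_sym by metis

context
  fixes p :: "'v \<Rightarrow> real" assumes p: "\<And>x. 0 \<le> p x"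
begin

text \<open>\<open>sep\<close> applied from both ends puts an edge inside \<open>B\<close> entirely
  into \<open>b i\<close>; an edge leaving \<open>B\<close> is constrained only at its outer
  end.\<close>

lemma block_BB: "i \<in> S \<Longrightarrow> block (A i) p B B \<le> (sum p (B \<inter> b i))\<^sup>2"
  unfolding power2_eq_square using finB p A1 sep sep' BV by (intro block_le_sum) auto

lemma block_BC: "i \<in> S \<Longrightarrow> block (A i) p B (V - B) \<le> sum p B * sum p ((V - B) \<inter> b i)"
  using block_le_sum[of B "V - B" p "A i" B "b i"] finB p A1 sep sep' BV by auto

lemma block_CC: "block (A i) p (V - B) (V - B) \<le> (sum p (V - B))\<^sup>2"
  using block_le_sum[of "V - B" "V - B" p "A i" UNIV UNIV] finB p A1 by (auto simp: power2_eq_square)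

lemma block_VV: "block (A i) p V V \<le> (sum p V)\<^sup>2"
  using block_le_sum[of V V p "A i" UNIV UNIV] finV p A1 by (auto simp: power2_eq_square)

lemma sqrt_block_VV: "sqrt (block (A i) p V V) \<le> sum p V"
  using block_VV[of i] p by (intro real_le_lsqrt) (auto intro: sum_nonneg)

lemma bound_no_B:
  assumes "sum p B = 0"
  shows "(\<Sum>i\<in>S. sqrt (block (A i) p V V)) \<le> real (card S) * sum p V - sum p B"
  using sum_bounded_above[of S "\<lambda>i. sqrt (block (A i) p V V)" "sum p V"] sqrt_block_VV assms by simp

text \<open>With no weight off \<open>B\<close>, the square root of the weight of colour
  \<open>i\<close> is at most the weight of \<open>b i\<close>, exactly the amount that
  \<open>IH\<close> saves on the remaining colours. Hence a single choice of \<open>i\<close>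
  suffices.\<close>

lemma bound_no_C:
  assumes "sum p (V - B) = 0" "S \<noteq> {}"
  shows "(\<Sum>i\<in>S. sqrt (block (A i) p V V)) \<le> real (card S) * sum p V - sum p B"
proof -
  obtain i where i: "i \<in> S" using assms by auto
  have p0: "p x = 0" if "x \<in> V - B" for x
    using assms(1) finB(2) p that by (simp add: sum_nonneg_eq_0_iff)
  have "block (A i) p V V = block (A i) p B B"
    unfolding split_block by (simp add: block_def p0)
  also have "sqrt \<dots> \<le> sum p (B \<inter> b i)"
    using block_BB[OF i] p by (intro real_le_lsqrt) (auto intro: sum_nonneg)
  also have "\<dots> \<le> sum p (V \<inter> b i)"
    using finV BV p by (intro sum_mono2) auto
  finally show ?thesis
    using IH[of p i, OF p i] assms split_sum[of p] finS i
    by (simp add: sum.remove[of S i] algebra_simps)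
qed

end

text \<open>For one colour the sum in \<open>IH\<close> is empty, so unit weights show that
  \<open>b i\<close> misses \<open>V\<close>. By \<open>sep\<close> no edge of this colour touches
  \<open>B\<close>.\<close>

lemma bound_one:
  assumes "card S = 1" and p: "\<And>x. 0 \<le> p x"
  shows "(\<Sum>i\<in>S. sqrt (block (A i) p V V)) \<le> real (card S) * sum p V - sum p B"
proof -
  obtain i where S: "S = {i}" using assms(1) card_1_singletonE by blast
  have "V \<inter> b i = {}"
    using IH[of "\<lambda>_. 1" i] finV by (simp add: S)
  then have b: "B \<inter> b i = {}" "(V - B) \<inter> b i = {}" using BV by auto
  have "block (A i) p V V \<le> (sum p (V - B))\<^sup>2"
    using block_BB[of p i] block_BC[of p i] block_CC[of p i] split_block[of i p] b p
    by (simp add: S)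
  then have "sqrt (block (A i) p V V) \<le> sum p (V - B)"
    using p by (intro real_le_lsqrt) (auto intro: sum_nonneg)
  then show ?thesis using split_sum[of p] by (simp add: S)
qed

text \<open>Two colours lie outside the range of \<open>stationary_sum_le\<close>. Here
  \<open>IH\<close> has a qualitative consequence: colour \<open>j\<close> has no edge at a vertex
  of \<open>b i\<close>. Together with \<open>sep\<close> this restricts the edges enough for an
  explicit rank-one majorant.\<close>

lemma bound_two:
  assumes "card S = 2" and p: "\<And>x. 0 \<le> p x"
  shows "(\<Sum>i\<in>S. sqrt (block (A i) p V V)) \<le> real (card S) * sum p V - sum p B"
proof -
  obtain i0 j0 where S: "S = {i0, j0}" "i0 \<noteq> j0" using assms(1) by (auto simp: card_2_iff)
  have zero: "A j v w = 0" if ij: "S = {i, j}" "i \<noteq> j" and v: "v \<in> V" "v \<in> b i" and w: "w \<in> V" for i j v w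
  proof (rule ccontr)
    assume "A j v w \<noteq> 0"
    then have pos: "A j v w > 0" using A0[of j v w] by simp
    define n where "n = real (card V)"
    have n: "n > 0" using finV v by (auto simp: n_def card_gt_0_iff)
    \<comment> \<open>The weighting \<open>q\<close> is \<open>1\<close> on \<open>b i\<close> and
      \<open>t\<close> elsewhere. The edge at \<open>v\<close> has weight at least
      \<open>t * A j v w\<close>, whereas \<open>IH\<close> allows at most \<open>(n * t)^2\<close>;
      this \<open>t\<close> makes the latter at most half of the former.\<close>
    define t where "t = min 1 (A j v w / (2 * n\<^sup>2))"
    have t: "0 < t" "t \<le> 1" "t * n\<^sup>2 \<le> A j v w / 2"
      using pos n by (auto simp: t_def field_simps min_def)
    define q where "q x = (if x \<in> b i then 1 else t)" for x
    have q: "0 \<le> q x" "t \<le> q x" for x using t by (auto simp: q_def)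
    have "A j v w * (q v * q w) \<le> (\<Sum>y\<in>V. A j v y * (q v * q y))"
      using w finV A0 q by (intro member_le_sum) auto
    also have "\<dots> \<le> block (A j) q V V"
      unfolding block_def using v finV A0 q
      by (intro member_le_sum[of v V "\<lambda>x. \<Sum>y\<in>V. A j x y * (q x * q y)"]) (auto intro!: sum_nonneg)
    finally have 1: "A j v w * (q v * q w) \<le> block (A j) q V V" .
    have "S - {i} = {j}" using ij by auto
    then have "sqrt (block (A j) q V V) \<le> sum q V - sum q (V \<inter> b i)"
      using IH[of q i] q ij assms(1) by simp
    also have "\<dots> = sum q (V - b i)"
      using finV by (metis add_diff_cancel_left' sum.Int_Diff)
    also have "\<dots> \<le> real (card (V - b i)) * t"
      by (intro sum_bounded_above) (auto simp: q_def)
    also have "\<dots> \<le> n * t" using t finV by (auto simp: n_def intro!: mult_right_mono card_mono)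
    finally have "block (A j) q V V \<le> (n * t)\<^sup>2"
      by (metis A0 block_nonneg q(1) real_sqrt_le_iff real_sqrt_unique sqrt_le_D)
    also have "\<dots> = t * (t * n\<^sup>2)" by (simp add: power2_eq_square)
    also have "\<dots> \<le> t * (A j v w / 2)" using t by (intro mult_left_mono) auto
    finally have 2: "A j v w * (q v * q w) \<le> t * (A j v w / 2)" using 1 by simp
    have "A j v w * t \<le> A j v w * (q v * q w)"
      using q v pos by (intro mult_left_mono) (auto simp: q_def)
    also have "\<dots> \<le> t * (A j v w / 2)" by (rule 2)
    finally have "A j v w * t \<le> t * (A j v w / 2)" .
    moreover have "0 < t * A j v w" using t pos by simp
    ultimately show False by (simp add: mult.commute)
  qed
  \<comment> \<open>A multiplicative certificate: \<open>f i j x * f i j y \<ge> 1\<close> on every edge \<open>xy\<close> of colour \<open>i\<close>.\<close>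
  define f where "f i j x = (if x \<in> b j then 0 else if x \<in> b i then (if x \<in> B then 1 else 2)
     else (if x \<in> B then 1/2 else 1 :: real))" for i j x
  have bd: "sqrt (block (A i) p V V) \<le> (\<Sum>x\<in>V. f i j x * p x)" if ij: "S = {i, j}" "i \<noteq> j" for i j
  proof (rule sqrt_le_of_le_mult, rule block_le)
    fix x y assume xy: "x \<in> V" "y \<in> V"
    have "A i x y = 0" if "x \<in> b j \<or> y \<in> b j"
      using zero[of j i x y] zero[of j i y x] that ij xy A_sym[of i x y] by auto
    moreover have "A i x y = 0" if "x \<in> B \<and> y \<notin> b i \<or> y \<in> B \<and> x \<notin> b i"
      using sep[of i x y] sep'[of i x y] that ij xy by auto
    ultimately show "A i x y \<le> f i j x * f i j y"
      using A1[of i x y] by (auto simp: f_def)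
  qed (auto simp: finV p f_def intro!: sum_nonneg mult_nonneg_nonneg)
  have "(\<Sum>i\<in>S. sqrt (block (A i) p V V)) \<le> (\<Sum>x\<in>V. f i0 j0 x * p x) + (\<Sum>x\<in>V. f j0 i0 x * p x)"
    using bd[of i0 j0] bd[of j0 i0] S by (simp add: insert_commute add_mono)
  also have "\<dots> = (\<Sum>x\<in>V. (f i0 j0 x + f j0 i0 x) * p x)"
    by (simp add: sum.distrib distrib_right)
  \<comment> \<open>Going through the positions of \<open>x\<close> relative to \<open>b i0\<close>
    and \<open>b j0\<close>, the two majorants add up to at most \<open>1\<close> on
    \<open>B\<close> and at most \<open>2\<close> elsewhere.\<close>
  also have "\<dots> \<le> (\<Sum>x\<in>V. (2 - of_bool (x \<in> B)) * p x)"
    using p by (intro sum_mono mult_right_mono) (auto simp: f_def)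
  also have "\<dots> = 2 * sum p V - (\<Sum>x\<in>V. of_bool (x \<in> B) * p x)"
    by (simp add: left_diff_distrib sum_subtractf sum_distrib_left)
  also have "(\<Sum>x\<in>V. of_bool (x \<in> B) * p x) = sum p (V \<inter> B)"
    using finV by (simp add: sum.inter_restrict of_bool_def if_distrib[of "\<lambda>c. c * _"] cong: if_cong)
  also have "V \<inter> B = B" using BV by auto
  finally show ?thesis using assms(1) by simp
qed

section \<open>Moving weight between \<open>B\<close> and its complement\<close>

definition rescale :: "real \<Rightarrow> real \<Rightarrow> ('v \<Rightarrow> real) \<Rightarrow> 'v \<Rightarrow> real" where
  "rescale s t p x = (if x \<in> B then s else t) * p x"

lemma sum_rescale:
  "X \<subseteq> B \<Longrightarrow> sum (rescale s t p) X = s * sum p X"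
  "X \<inter> B = {} \<Longrightarrow> sum (rescale s t p) X = t * sum p X"
proof -
  have "sum (rescale s t p) X = (\<Sum>x\<in>X. s * p x)" if "X \<subseteq> B"
    using that by (intro sum.cong) (auto simp: rescale_def)
  then show "X \<subseteq> B \<Longrightarrow> sum (rescale s t p) X = s * sum p X" by (simp add: sum_distrib_left)
  have "sum (rescale s t p) X = (\<Sum>x\<in>X. t * p x)" if "X \<inter> B = {}"
    using that by (intro sum.cong) (auto simp: rescale_def)
  then show "X \<inter> B = {} \<Longrightarrow> sum (rescale s t p) X = t * sum p X" by (simp add: sum_distrib_left)
qed

lemma block_rescale:
  "block M (rescale s t p) B B = s\<^sup>2 * block M p B B"
  "block M (rescale s t p) B (V - B) = s * t * block M p B (V - B)"
  "block M (rescale s t p) (V - B) (V - B) = t\<^sup>2 * block M p (V - B) (V - B)"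
  unfolding block_def sum_distrib_left
  by (intro sum.cong refl; simp add: rescale_def power2_eq_square)+

text \<open>Normalise a violating \<open>p\<close> to total weight \<open>1\<close> and vary only
  the share of \<open>B\<close>, up to the worst violation. Neither extreme share violates the
  bound, by \<open>bound_no_B\<close> and \<open>bound_no_C\<close>, so the maximum is interior and
  \<open>block_scaling_max\<close> contradicts \<open>stationary_sum_le\<close>. Colour sets of size
  one and two are settled beforehand.\<close>

lemma planted_bound:
  assumes "S \<noteq> {}" and p: "\<And>x. 0 \<le> p x"
  shows "(\<Sum>i\<in>S. sqrt (block (A i) p V V)) \<le> real (card S) * sum p V - sum p B"
proof (rule ccontr)
  assume neg: "\<not> ?thesis"
  define k where "k = real (card S)"
  have "card S \<noteq> 0" "card S \<noteq> 1" "card S \<noteq> 2"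
    using assms finS bound_one[OF _ p] bound_two[OF _ p] neg by auto
  then have k3: "card S \<ge> 3" by linarith
  define \<beta>0 \<gamma>0 where "\<beta>0 = sum p B" and "\<gamma>0 = sum p (V - B)"
  have "\<beta>0 \<noteq> 0" "\<gamma>0 \<noteq> 0"
    using bound_no_B[of p] bound_no_C[of p] p neg assms(1) by (auto simp: \<beta>0_def \<gamma>0_def)
  moreover have "\<beta>0 \<ge> 0" "\<gamma>0 \<ge> 0" unfolding \<beta>0_def \<gamma>0_def by (intro sum_nonneg p)+
  ultimately have pos: "\<beta>0 > 0" "\<gamma>0 > 0" by auto
  \<comment> \<open>The block weights after \<open>p\<close> is normalised to weight
    \<open>1\<close> on \<open>B\<close> and on \<open>V - B\<close> separately, so that the share
    enters only through factors \<theta> and \<open>1 - \<theta>\<close>.\<close>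
  define a e c where "a i = block (A i) p B B / \<beta>0\<^sup>2" and "e i = block (A i) p B (V - B) / (\<beta>0 * \<gamma>0)"
    and "c i = block (A i) p (V - B) (V - B) / \<gamma>0\<^sup>2" for i
  define R where "R i \<theta> = a i * \<theta>\<^sup>2 + 2 * e i * (\<theta> * (1 - \<theta>)) + c i * (1 - \<theta>)\<^sup>2" for i \<theta>
  define G where "G \<theta> = (\<Sum>i\<in>S. sqrt (R i \<theta>)) + \<theta> - k" for \<theta>
  define q where "q \<theta> = rescale (\<theta> / \<beta>0) ((1 - \<theta>) / \<gamma>0) p" for \<theta>
  have qB: "sum (q \<theta>) B = \<theta>" "sum (q \<theta>) (V - B) = 1 - \<theta>" "sum (q \<theta>) V = 1" for \<theta>
  proof -
    show 1: "sum (q \<theta>) B = \<theta>" "sum (q \<theta>) (V - B) = 1 - \<theta>"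
      using pos sum_rescale(1)[of B] sum_rescale(2)[of "V - B", unfolded Int_commute[of _ B], OF Diff_disjoint]
      by (auto simp: q_def simp flip: \<beta>0_def \<gamma>0_def)
    show "sum (q \<theta>) V = 1" using split_sum[of "q \<theta>"] 1 by simp
  qed
  have blk: "block (A i) (q \<theta>) B B = a i * \<theta>\<^sup>2"
    "block (A i) (q \<theta>) B (V - B) = e i * (\<theta> * (1 - \<theta>))"
    "block (A i) (q \<theta>) (V - B) (V - B) = c i * (1 - \<theta>)\<^sup>2" for i \<theta>
    unfolding q_def block_rescale a_def e_def c_def by (simp_all add: power_divide)
  have Rq: "block (A i) (q \<theta>) V V = R i \<theta>" for i \<theta>
    unfolding split_block blk R_def by simp
  have q0: "0 \<le> q \<theta> x" if "0 \<le> \<theta>" "\<theta> \<le> 1" for \<theta> x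
    using that pos p by (simp add: q_def rescale_def)
  \<comment> \<open>The share of \<open>B\<close> under \<open>p\<close> itself, at which
    \<open>q\<close> is \<open>p\<close> divided by its total weight.\<close>
  define \<theta>0 where "\<theta>0 = \<beta>0 / (\<beta>0 + \<gamma>0)"
  have \<theta>0: "0 \<le> \<theta>0" "\<theta>0 \<le> 1" using pos by (auto simp: \<theta>0_def)
  have G0: "G \<theta>0 > 0"
  proof -
    define m where "m = \<beta>0 + \<gamma>0"
    have m: "m > 0" "sum p V = m" using pos split_sum[of p] by (auto simp: m_def \<beta>0_def \<gamma>0_def)
    have th: "\<theta>0 / \<beta>0 = 1 / m" "(1 - \<theta>0) / \<gamma>0 = 1 / m"
    proof -
      have "1 - \<theta>0 = \<gamma>0 / m" using m by (simp add: \<theta>0_def m_def divide_simps)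
      then show "\<theta>0 / \<beta>0 = 1 / m" "(1 - \<theta>0) / \<gamma>0 = 1 / m"
        using pos by (simp_all add: \<theta>0_def m_def)
    qed
    have qp: "q \<theta>0 = (\<lambda>x. p x / m)" unfolding q_def th by (auto simp: rescale_def)
    have "R i \<theta>0 = block (A i) p V V / m\<^sup>2" for i
      unfolding Rq[symmetric] qp block_def by (simp add: sum_divide_distrib power2_eq_square)
    then have "sqrt (R i \<theta>0) = sqrt (block (A i) p V V) / m" for i
      using m by (simp add: real_sqrt_divide)
    then have "G \<theta>0 = (\<Sum>i\<in>S. sqrt (block (A i) p V V)) / m + \<beta>0 / m - k"
      by (simp add: G_def sum_divide_distrib \<theta>0_def m_def)
    also have "\<dots> = ((\<Sum>i\<in>S. sqrt (block (A i) p V V)) - (k * m - \<beta>0)) / m"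
      using m by (simp add: field_simps)
    also have "\<dots> > 0" using neg m by (simp add: k_def \<beta>0_def)
    finally show ?thesis .
  qed
  \<comment> \<open>\<open>q \<theta>\<close> keeps the shape of \<open>p\<close> on \<open>B\<close> and off \<open>B\<close> but gives \<open>B\<close> the share \<open>\<theta>\<close> of the total weight;
    choosing the worst share makes the derivative vanish.\<close>
  obtain \<theta> where \<theta>: "0 \<le> \<theta>" "\<theta> \<le> 1" "G \<theta>0 \<le> G \<theta>" and
    stat: "0 < \<theta> \<and> \<theta> < 1 \<and> (\<forall>i\<in>S. R i \<theta> > 0) \<longrightarrow>
       (\<Sum>i\<in>S. (a i * \<theta>\<^sup>2 + e i * (\<theta> * (1 - \<theta>))) / sqrt (R i \<theta>)) = \<theta> * (k - 1 + G \<theta>)"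
    by (rule block_scaling_max[where S = S and a = a and e = e and c = c and k = k, OF \<theta>0,
          folded R_def, folded G_def])
  define r where "r i = sqrt (R i \<theta>)" for i
  define \<epsilon> where "\<epsilon> = G \<theta>"
  have \<epsilon>: "\<epsilon> > 0" using \<theta>(3) G0 by (simp add: \<epsilon>_def)
  have qn: "\<And>x. 0 \<le> q \<theta> x" using q0 \<theta> by simp
  have sum_r: "(\<Sum>i\<in>S. r i) = k - \<theta> + \<epsilon>" by (simp add: r_def \<epsilon>_def G_def)
  have "\<theta> \<noteq> 0" using bound_no_B[of "q \<theta>"] qn sum_r \<epsilon> by (auto simp: qB Rq r_def k_def)
  moreover have "\<theta> \<noteq> 1"
    using bound_no_C[of "q \<theta>"] qn sum_r \<epsilon> assms(1) by (auto simp: qB Rq r_def k_def)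
  ultimately have t01: "0 < \<theta>" "\<theta> < 1" using \<theta> by auto
  \<comment> \<open>Chosen so that the \<open>r i\<close> sum to \<open>k - 1 + \<tau>\<close>; then
    \<open>IH\<close> for \<open>S - {i}\<close> becomes
    \<open>x i + z i \<le> r i - \<tau>\<close>. In particular every \<open>r i\<close> is positive,
    so the square roots are differentiable.\<close>
  define \<tau> where "\<tau> = 1 - \<theta> + \<epsilon>"
  define x z where "x i = sum (q \<theta>) (B \<inter> b i)" and "z i = sum (q \<theta>) ((V - B) \<inter> b i)" for i
  have r1: "r i \<le> 1" for i using sqrt_block_VV[of "q \<theta>" i] qn by (simp add: qB Rq r_def)
  have xz0: "0 \<le> x i" "0 \<le> z i" for i unfolding x_def z_def by (intro sum_nonneg qn)+
  have xz: "x i + z i \<le> r i - \<tau>" if "i \<in> S" for i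
  proof -
    have "sum (q \<theta>) (V \<inter> b i) = x i + z i"
      unfolding x_def z_def using finV BV
      by (subst sum.union_disjoint[symmetric]) (auto intro: arg_cong[of _ _ "sum (q \<theta>)"] finite_subset)
    moreover have "(\<Sum>j\<in>S - {i}. r j) = k - \<theta> + \<epsilon> - r i"
      using sum_r finS that by (simp add: sum.remove[of S i])
    ultimately show ?thesis
      using IH[of "q \<theta>" i] qn that by (simp add: qB Rq \<tau>_def k_def flip: r_def)
  qed
  have \<tau>0: "0 < \<tau>" using t01 \<epsilon> by (simp add: \<tau>_def)
  have rpos: "0 < r i" if "i \<in> S" for i using xz[OF that] xz0[of i] \<tau>0 by linarith
  have Rpos: "0 < R i \<theta>" if "i \<in> S" for i using rpos[OF that] by (simp add: r_def)
  have r2: "(r i)\<^sup>2 = R i \<theta>" if "i \<in> S" for i using Rpos[OF that] by (simp add: r_def)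
  have "(\<Sum>i\<in>S. (a i * \<theta>\<^sup>2 + e i * (\<theta> * (1 - \<theta>))) / r i) \<le> (real (card S) - 1) * \<theta>"
  proof (rule stationary_sum_le[where x = x and z = z and \<tau> = \<tau>])
    fix i assume i: "i \<in> S"
    show "a i * \<theta>\<^sup>2 \<le> (x i)\<^sup>2"
      using block_BB[of "q \<theta>" i] qn i by (simp add: blk x_def)
    show "e i * (\<theta> * (1 - \<theta>)) \<le> \<theta> * z i"
      using block_BC[of "q \<theta>" i] qn i by (simp add: blk z_def qB)
    have "0 \<le> block (A i) (q \<theta>) (V - B) (V - B)" by (intro block_nonneg A0 qn)
    then show "a i * \<theta>\<^sup>2 + 2 * (e i * (\<theta> * (1 - \<theta>))) \<le> (r i)\<^sup>2"
      unfolding r2[OF i] R_def blk by simp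
    have "x i \<le> sum (q \<theta>) B" unfolding x_def using finB qn by (intro sum_mono2) auto
    then show "x i \<le> \<theta>" by (simp add: qB)
    have "z i \<le> sum (q \<theta>) (V - B)" unfolding z_def using finB qn by (intro sum_mono2) auto
    then show "z i \<le> 1 - \<theta>" by (simp add: qB)
  qed (use finS k3 t01 \<epsilon> xz0 r1 xz sum_r in \<open>auto simp: \<tau>_def k_def\<close>)
  also have "(\<Sum>i\<in>S. (a i * \<theta>\<^sup>2 + e i * (\<theta> * (1 - \<theta>))) / r i) = \<theta> * (k - 1 + \<epsilon>)"
    using stat t01 Rpos by (simp add: r_def \<epsilon>_def)
  finally have "\<theta> * \<epsilon> \<le> 0" by (simp add: k_def algebra_simps)
  then show False using t01 \<epsilon> by (simp add: mult_le_0_iff)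
qed

end

section \<open>Rooted trees in graphs\<close>

text \<open>\<open>Br s t\<close> is \<open>t\<close> with one more child attached to its root, the child carrying the subtree \<open>s\<close>.\<close>

datatype rtree = Leaf | Br rtree rtree

fun tree_size :: "rtree \<Rightarrow> nat" where
  "tree_size Leaf = 0"
| "tree_size (Br s t) = Suc (tree_size s + tree_size t)"

inductive realizes :: "rtree \<Rightarrow> 'a \<Rightarrow> 'a set \<Rightarrow> 'a set set \<Rightarrow> bool" where
  Leaf: "realizes Leaf w {w} {}"
| Br: "realizes s u W1 E1 \<Longrightarrow> realizes t w W2 E2 \<Longrightarrow> W1 \<inter> W2 = {} \<Longrightarrow>
    realizes (Br s t) w (W1 \<union> W2) (insert {w, u} (E1 \<union> E2))"

lemma realizes_basic:
  assumes "realizes t w W E"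
  shows "finite W \<and> w \<in> W \<and> E \<subseteq> nsets W 2 \<and> card W = Suc (tree_size t) \<and> card E = tree_size t"
  using assms
proof induction
  case (Leaf w)
  then show ?case by simp
next
  case (Br s u W1 E1 t w W2 E2)
  have sub: "E1 \<subseteq> Pow W1" "E2 \<subseteq> Pow W2" using Br.IH by (auto simp: nsets_def)
  have "finite E1" "finite E2"
    using sub Br.IH by (auto intro: finite_subset[OF _ iffD2[OF finite_Pow_iff]])
  moreover have "{w, u} \<notin> E1 \<union> E2" using sub Br by blast
  moreover have "E1 \<inter> E2 = {}"
  proof (rule ccontr)
    assume "E1 \<inter> E2 \<noteq> {}"
    then obtain e where e: "e \<in> E1" "e \<in> E2" by auto
    then have "e = {}" using sub Br.hyps by blast
    then show False using e Br.IH by (auto simp: nsets_def)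
  qed
  moreover have "w \<noteq> u" using Br by auto
  then have "{w, u} \<in> nsets (W1 \<union> W2) 2" using Br by (auto simp: nsets_def)
  moreover have "E1 \<union> E2 \<subseteq> nsets (W1 \<union> W2) 2" using Br.IH by (auto simp: nsets_def)
  moreover have "card (W1 \<union> W2) = card W1 + card W2"
    using Br.IH Br.hyps(3) by (intro card_Un_disjoint) auto
  ultimately show ?case using Br.IH by (auto simp: card_Un_disjoint)
qed

text \<open>The isomorphisms of the two subtrees are glued along disjoint vertex sets. The shape
  alone thus identifies a rainbow tree found later as a copy of \<open>H\<close>.\<close>

lemma realizes_unique:
  assumes "realizes t w W E" "realizes t w' W' E'"
  shows "\<exists>f. bij_betw f W W' \<and> f w = w' \<and> E' = (`) f ` E"
  using assms
proof (induction arbitrary: w' W' E')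
  case (Leaf w)
  then show ?case by (auto elim!: realizes.cases[of Leaf] intro!: exI[of _ "\<lambda>_. w'"] simp: bij_betw_def)
next
  case (Br s u W1 E1 t w W2 E2)
  obtain u' W1' E1' W2' E2' where *: "realizes s u' W1' E1'" "realizes t w' W2' E2'" "W1' \<inter> W2' = {}"
    "W' = W1' \<union> W2'" "E' = insert {w', u'} (E1' \<union> E2')"
    using Br.prems by (cases rule: realizes.cases) auto
  obtain f1 where f1: "bij_betw f1 W1 W1'" "f1 u = u'" "E1' = (`) f1 ` E1" using Br.IH(1)[OF *(1)] by auto
  obtain f2 where f2: "bij_betw f2 W2 W2'" "f2 w = w'" "E2' = (`) f2 ` E2" using Br.IH(2)[OF *(2)] by auto
  define f where "f x = (if x \<in> W1 then f1 x else f2 x)" for x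
  have b1: "u \<in> W1" "E1 \<subseteq> Pow W1" "w \<in> W2" "E2 \<subseteq> Pow W2"
    using realizes_basic[OF Br.hyps(1)] realizes_basic[OF Br.hyps(2)] by (auto simp: nsets_def)
  have fW1: "f x = f1 x" if "x \<in> W1" for x using that by (simp add: f_def)
  have fW2: "f x = f2 x" if "x \<in> W2" for x using that Br.hyps(3) by (auto simp: f_def)
  have "bij_betw f W1 W1'" "bij_betw f W2 W2'"
    using f1(1) f2(1) fW1 fW2 bij_betw_cong[of W1 f f1] bij_betw_cong[of W2 f f2] by auto
  then have "bij_betw f (W1 \<union> W2) (W1' \<union> W2')" using *(3) by (rule bij_betw_combine)
  moreover have "f w = w'" using b1 fW2 f2 by simp
  moreover have "f ` e = f1 ` e" if "e \<in> E1" for e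
    using that b1(2) fW1 by (intro image_cong refl) blast
  moreover have "f ` e = f2 ` e" if "e \<in> E2" for e
    using that b1(4) fW2 by (intro image_cong refl) blast
  moreover have "f u = u'" using b1 fW1 f1 by simp
  ultimately show ?case unfolding *(4,5) f1(3) f2(3)
    by (intro exI[of _ f]) (auto simp: image_Un image_iff)
qed

lemma graph_isoI:
  assumes "bij_betw f (verts G) (verts H)" "edges H = (`) f ` edges G" "edges G \<subseteq> Pow (verts G)"
  shows "graph_iso G H"
  unfolding graph_iso_def
proof (intro exI[of _ f] conjI ballI)
  fix u v assume uv: "u \<in> verts G" "v \<in> verts G"
  show "{u, v} \<in> edges G \<longleftrightarrow> {f u, f v} \<in> edges H"
  proof
    assume "{f u, f v} \<in> edges H"
    then have "f ` {u, v} \<in> (`) f ` edges G" using assms(2) by simp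
    then obtain e where e: "e \<in> edges G" "f ` {u, v} = f ` e" by blast
    then have "{u, v} = e"
      using inj_on_image_eq_iff[of f "verts G" "{u, v}" e] assms uv by (auto simp: bij_betw_def)
    then show "{u, v} \<in> edges G" using e by simp
  next
    assume "{u, v} \<in> edges G"
    then have "f ` {u, v} \<in> edges H" using assms(2) by blast
    then show "{f u, f v} \<in> edges H" by simp
  qed
qed (rule assms(1))

lemma edge_endpoints:
  assumes "simple_graph G" "e \<in> edges G"
  obtains u v where "e = {u, v}" "u \<in> verts G" "v \<in> verts G" "u \<noteq> v"
proof -
  have "e \<in> nsets (verts G) 2" using assms by (auto simp: simple_graph_def)
  then show ?thesis using that by (auto simp: nsets_def card_2_iff)
qed

lemma graph_isoE:
  assumes "graph_iso G H" "simple_graph G" "simple_graph H"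
  obtains f where "bij_betw f (verts G) (verts H)" "edges H = (`) f ` edges G"
proof -
  from assms(1) obtain f where f0: "bij_betw f (verts G) (verts H) \<and>
      (\<forall>u\<in>verts G. \<forall>v\<in>verts G. {u, v} \<in> edges G \<longleftrightarrow> {f u, f v} \<in> edges H)"
    unfolding graph_iso_def ..
  note f = conjunct1[OF f0] conjunct2[OF f0, rule_format]
  have "edges H = (`) f ` edges G"
  proof (intro equalityI subsetI)
    fix e assume e: "e \<in> edges H"
    then obtain u v where uv: "e = {u, v}" "u \<in> verts H" "v \<in> verts H"
      by (rule edge_endpoints[OF assms(3)])
    have "verts H = f ` verts G" using f(1) by (simp add: bij_betw_def)
    then obtain u' v' where "u' \<in> verts G" "v' \<in> verts G" "u = f u'" "v = f v'"
      using uv(2,3) by (metis imageE)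
    then have "{u', v'} \<in> edges G" "e = f ` {u', v'}" using f(2)[of u' v'] e uv(1) by simp_all
    then show "e \<in> (`) f ` edges G" by (rule rev_image_eqI)
  next
    fix e assume "e \<in> (`) f ` edges G"
    then obtain e' where e': "e = f ` e'" "e' \<in> edges G" by auto
    obtain u v where uv: "e' = {u, v}" "u \<in> verts G" "v \<in> verts G"
      by (rule edge_endpoints[OF assms(2) e'(2)])
    then show "e \<in> edges H" using f(2)[of u v] e' by simp
  qed
  then show ?thesis by (rule that[OF f(1)])
qed

lemma realizes_iso:
  assumes "realizes t w (verts G) (edges G)" "realizes t w' (verts H) (edges H)"
  shows "graph_iso G H"
proof -
  obtain f where "bij_betw f (verts G) (verts H)" "edges H = (`) f ` edges G"
    using realizes_unique[OF assms] by blast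
  moreover have "edges G \<subseteq> Pow (verts G)"
    using realizes_basic[OF assms(1)] by (auto simp: nsets_def)
  ultimately show ?thesis by (rule graph_isoI)
qed

section \<open>Every tree has a rooted shape\<close>

lemma realizes_add_leaf:
  assumes "realizes t w W E" "p \<in> W" "l \<notin> W"
  shows "\<exists>t'. realizes t' w (insert l W) (insert {p, l} E)"
  using assms
proof (induction)
  case (Leaf w)
  then show ?case using realizes.Br[OF realizes.Leaf[of l] realizes.Leaf[of w]] by (auto simp: insert_commute)
next
  case (Br s u W1 E1 t w W2 E2)
  show ?case
  proof (cases "p \<in> W1")
    case True
    then obtain s' where "realizes s' u (insert l W1) (insert {p, l} E1)" using Br by auto
    from realizes.Br[OF this Br.hyps(2)] Br.hyps(3) Br.prems show ?thesis
      by (auto simp: insert_commute)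
  next
    case False
    then obtain t' where "realizes t' w (insert l W2) (insert {p, l} E2)" using Br by auto
    from realizes.Br[OF Br.hyps(1) this] Br.hyps(3) Br.prems show ?thesis
      by (auto simp: insert_commute)
  qed
qed

text \<open>For vertices on different sides of \<open>{w, u}\<close>, paths to the two roots are
  concatenated across that edge. The path serves to close a cycle in
  \<open>tree_realizes\<close>.\<close>

lemma realizes_path:
  assumes "realizes t w W E" "x \<in> W" "y \<in> W"
  shows "\<exists>xs. xs \<noteq> [] \<and> hd xs = x \<and> last xs = y \<and> distinct xs \<and> set xs \<subseteq> W \<and>
    successively (\<lambda>u v. {u, v} \<in> E) xs"
  using assms
proof (induction arbitrary: x y)
  case (Leaf w)
  then show ?case by (intro exI[of _ "[w]"]) auto
next
  case (Br s u W1 E1 t w W2 E2)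
  have uw: "u \<in> W1" "w \<in> W2" using realizes_basic[OF Br.hyps(1)] realizes_basic[OF Br.hyps(2)] by auto
  let ?E = "insert {w, u} (E1 \<union> E2)"
  have mono: "successively (\<lambda>u v. {u, v} \<in> E1) xs \<Longrightarrow> successively (\<lambda>u v. {u, v} \<in> ?E) xs"
    "successively (\<lambda>u v. {u, v} \<in> E2) xs \<Longrightarrow> successively (\<lambda>u v. {u, v} \<in> ?E) xs" for xs
    by (auto elim: successively_mono)
  let ?path = "\<lambda>xs a b. xs \<noteq> [] \<and> hd xs = a \<and> last xs = b \<and> distinct xs \<and> set xs \<subseteq> W1 \<union> W2 \<and>
      successively (\<lambda>u v. {u, v} \<in> ?E) xs"
  have join: "?path (as @ bs) a d" if "?path as a b" "?path bs c d" "{b, c} = {w, u}" "set as \<inter> set bs = {}"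
    for as bs a b c d
    using that by (simp add: successively_append_iff)
  have lift: "\<exists>xs. ?path xs a b \<and> set xs \<subseteq> W1" if "a \<in> W1" "b \<in> W1" for a b
    using Br.IH(1)[OF that] mono(1) by blast
  have lift': "\<exists>xs. ?path xs a b \<and> set xs \<subseteq> W2" if "a \<in> W2" "b \<in> W2" for a b
    using Br.IH(2)[OF that] mono(2) by blast
  consider "x \<in> W1" "y \<in> W1" | "x \<in> W2" "y \<in> W2" | "x \<in> W1" "y \<in> W2" | "x \<in> W2" "y \<in> W1"
    using Br.prems by auto
  then show ?case
  proof cases
    case 1
    then show ?thesis using lift by blast
  next
    case 2
    then show ?thesis using lift' by blast
  next
    case 3
    obtain as where as: "?path as x u" "set as \<subseteq> W1" using lift[of x u] 3 uw by auto
    obtain bs where bs: "?path bs w y" "set bs \<subseteq> W2" using lift'[of w y] 3 uw by auto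
    have "set as \<inter> set bs = {}" using as(2) bs(2) Br.hyps(3) by blast
    from join[OF as(1) bs(1) insert_commute this] show ?thesis by (rule exI)
  next
    case 4
    obtain as where as: "?path as x w" "set as \<subseteq> W2" using lift'[of x w] 4 uw by auto
    obtain bs where bs: "?path bs u y" "set bs \<subseteq> W1" using lift[of u y] 4 uw by auto
    have "set as \<inter> set bs = {}" using as(2) bs(2) Br.hyps(3) by blast
    from join[OF as(1) bs(1) refl this] show ?thesis by (rule exI)
  qed
qed

lemma connected_crossing_edge:
  assumes "connected_graph G" "W \<subseteq> verts G" "W \<noteq> {}" "W \<noteq> verts G"
  obtains p l where "p \<in> W" "l \<in> verts G - W" "{p, l} \<in> edges G"
proof -
  obtain u v where uv: "u \<in> W" "v \<in> verts G" "v \<notin> W" using assms by blast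
  then obtain xs where xs: "walk G xs" "hd xs = u" "last xs = v"
    using assms(1,2) unfolding connected_graph_def by blast
  have "\<exists>p l. p \<in> W \<and> l \<in> verts G - W \<and> {p, l} \<in> edges G"
    if "walk G xs" "hd xs \<in> W" "last xs \<notin> W" for xs
    using that
  proof (induction xs)
    case (Cons a xs)
    show ?case
    proof (cases xs)
      case (Cons c ys)
      then show ?thesis
        using Cons.prems Cons.IH by (cases "c \<in> W") (auto simp: walk_def)
    qed (use Cons.prems in auto)
  qed (simp add: walk_def)
  then show ?thesis using xs uv that by blast
qed

text \<open>A realized subtree with the most vertices spans \<open>T\<close>: connectedness supplies
  an edge leaving any smaller one, and \<open>realizes_add_leaf\<close> absorbs it. An edge of
  \<open>T\<close> outside it would close a cycle with the path joining its ends.\<close>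

lemma tree_realizes:
  assumes "tree T"
  obtains t w where "realizes t w (verts T) (edges T)"
proof -
  have T: "finite (verts T)" "edges T \<subseteq> nsets (verts T) 2" "connected_graph T" "\<And>xs. \<not> cycle T xs"
    using assms by (auto simp: tree_def simple_graph_def)
  define P where "P W \<longleftrightarrow> (\<exists>t w E. realizes t w W E \<and> W \<subseteq> verts T \<and> E \<subseteq> edges T)" for W
  obtain w0 where "w0 \<in> verts T" using T(3) by (auto simp: connected_graph_def)
  then have "P {w0}" unfolding P_def using realizes.Leaf[of w0] by auto
  moreover have "\<forall>W. P W \<longrightarrow> card W < Suc (card (verts T))"
    using T(1) by (auto simp: P_def less_Suc_eq_le intro: card_mono)
  ultimately obtain W where W: "P W" "\<And>W'. P W' \<Longrightarrow> card W' \<le> card W"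
    using ex_has_greatest_nat[of P "{w0}" card] by blast
  obtain t w E where E: "realizes t w W E" "W \<subseteq> verts T" "E \<subseteq> edges T" using W(1) P_def by auto
  have fW: "finite W" "W \<noteq> {}" using realizes_basic[OF E(1)] by auto
  have "W = verts T"
  proof (rule ccontr)
    assume "W \<noteq> verts T"
    then obtain p l where pl: "p \<in> W" "l \<in> verts T - W" "{p, l} \<in> edges T"
      using connected_crossing_edge[OF T(3) E(2) fW(2)] by auto
    then obtain t' where "realizes t' w (insert l W) (insert {p, l} E)"
      using realizes_add_leaf[OF E(1), of p l] by auto
    then have "P (insert l W)" unfolding P_def using pl E by blast
    then show False using W(2)[of "insert l W"] pl fW by simp
  qed
  moreover have "edges T \<subseteq> E"
  proof
    fix e assume e: "e \<in> edges T"
    then obtain x y where xy: "e = {x, y}" "x \<in> W" "y \<in> W" "x \<noteq> y"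
      using T(2) \<open>W = verts T\<close> by (auto simp: nsets_def card_2_iff)
    show "e \<in> E"
    proof (rule ccontr)
      assume ne: "e \<notin> E"
      obtain xs where xs: "xs \<noteq> []" "hd xs = x" "last xs = y" "distinct xs" "set xs \<subseteq> W"
        "successively (\<lambda>u v. {u, v} \<in> E) xs" using realizes_path[OF E(1) xy(2,3)] by blast
      have "length xs \<ge> 3"
      proof (rule ccontr)
        assume "\<not> ?thesis"
        moreover have "length xs \<noteq> 0" using xs(1) by simp
        ultimately have "length xs = 1 \<or> length xs = 2" by linarith
        then show False
        proof
          assume "length xs = 1"
          then show False using xs(2,3) xy(4) by (auto simp: length_Suc_conv)
        next
          assume "length xs = 2"
          then obtain a b where "xs = [a, b]" by (auto simp: length_Suc_conv numeral_2_eq_2)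
          then show False using xs ne xy by auto
        qed
      qed
      moreover have "successively (\<lambda>u v. {u, v} \<in> edges T) xs"
        using xs(6) E(3) by (auto elim: successively_mono)
      ultimately have "cycle T xs"
        using xs E e xy by (auto simp: cycle_def walk_def insert_commute)
      then show False using T(4) by blast
    qed
  qed
  ultimately show ?thesis using that E by (metis subset_antisym)
qed

lemma star_realizes: "\<exists>t. realizes t 0 (verts (star_graph k)) (edges (star_graph k))"
proof (induction k)
  case 0
  then show ?case using realizes.Leaf[of "0::nat"] by (auto simp: star_graph_def)
next
  case (Suc k)
  then obtain t where t: "realizes t 0 {0..k} {{0, i} | i. i \<in> {1..k}}" by (auto simp: star_graph_def)
  have 1: "insert (Suc k) {0..k} = {0..Suc k}" by auto
  have 2: "insert {0, Suc k} {{0, i} | i. i \<in> {1..k}} = {{0, i} | i. i \<in> {1..Suc k}}"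
    by (auto simp: atLeastAtMostSuc_conv)
  show ?case using realizes_add_leaf[OF t, of 0 "Suc k"] unfolding 1 2 by (simp add: star_graph_def)
qed

section \<open>Rainbow trees in dense systems\<close>

text \<open>The shapes at which \<open>planted\<close> will be applied: \<open>s\<close> is
  collected for every \<open>Br s _\<close> occurring anywhere in the tree.\<close>

fun child_subtrees :: "rtree \<Rightarrow> rtree set" where
  "child_subtrees Leaf = {}"
| "child_subtrees (Br s t) = insert s (child_subtrees s \<union> child_subtrees t)"

lemma finite_child_subtrees: "finite (child_subtrees t)"
  by (induction t) auto

text \<open>\<open>roots D V E t S\<close> is the set of possible roots of rainbow copies of \<open>t\<close> with colour set \<open>S\<close>. Requiring
  \<open>D\<close> neighbours instead of one leaves room to avoid the vertices already used in a greedy embedding.\<close>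

fun roots :: "nat \<Rightarrow> 'v set \<Rightarrow> (nat \<Rightarrow> 'v set set) \<Rightarrow> rtree \<Rightarrow> nat set \<Rightarrow> 'v set" where
  "roots D V E Leaf S = V"
| "roots D V E (Br s t) S = {v \<in> V. \<exists>i S1 S2. S = insert i (S1 \<union> S2) \<and> i \<notin> S1 \<union> S2 \<and> S1 \<inter> S2 = {} \<and>
     card S1 = tree_size s \<and> card S2 = tree_size t \<and> v \<in> roots D V E t S2 \<and>
     D \<le> card {u \<in> roots D V E s S1. {v, u} \<in> E i}}"

lemma roots_subset: "roots D V E t S \<subseteq> V"
  by (cases t) auto

lemma roots_BrI:
  assumes "v \<in> V" "i \<notin> S" "card S = tree_size s" "D \<le> card {u \<in> roots D V E s S. {v, u} \<in> E i}"
  shows "v \<in> roots D V E (Br s Leaf) (insert i S)"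
  unfolding roots.simps mem_Collect_eq
  by (rule conjI[OF assms(1)], rule exI[of _ i], rule exI[of _ S], rule exI[of _ "{}"]) (use assms in auto)

text \<open>Greedy: the part \<open>t\<close> at \<open>v\<close> is embedded first, avoiding
  \<open>X\<close>. It and \<open>X\<close> occupy fewer than \<open>D\<close> vertices, so one of
  the candidate neighbours is free as root of \<open>s\<close>, which is then embedded off
  everything used. Disjoint colour sets keep \<psi> injective.\<close>

lemma roots_embed:
  assumes "finite V" "v \<in> roots D V E t S" "finite S" "card S = tree_size t"
    and "finite X" "v \<notin> X" "card X + tree_size t < D"
  shows "\<exists>W F \<psi>. realizes t v W F \<and> W \<subseteq> V \<and> W \<inter> X = {} \<and> inj_on \<psi> F \<and> \<psi> ` F \<subseteq> S \<and>
    (\<forall>e\<in>F. e \<in> E (\<psi> e))"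
  using assms
proof (induction t arbitrary: v S X)
  case Leaf
  then show ?case using realizes.Leaf[of v] by (intro exI[of _ "{v}"] exI[of _ "{}"]) auto
next
  case (Br s t)
  obtain i S1 S2 where S: "S = insert i (S1 \<union> S2)" "i \<notin> S1 \<union> S2" "S1 \<inter> S2 = {}"
    "card S1 = tree_size s" "card S2 = tree_size t" "v \<in> roots D V E t S2"
    "D \<le> card {u \<in> roots D V E s S1. {v, u} \<in> E i}"
    using Br.prems(2) by auto
  have fin: "finite S1" "finite S2" using Br.prems(3) S(1) by auto
  obtain W2 F2 \<psi>2 where 2: "realizes t v W2 F2" "W2 \<subseteq> V" "W2 \<inter> X = {}" "inj_on \<psi>2 F2" "\<psi>2 ` F2 \<subseteq> S2"
    "\<forall>e\<in>F2. e \<in> E (\<psi>2 e)"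
    using Br.IH(2)[of v S2 X] Br.prems S fin by auto
  note b2 = realizes_basic[OF 2(1)]
  have "card (X \<union> W2) \<le> card X + Suc (tree_size t)" using card_Un_le[of X W2] b2 by simp
  also have "\<dots> < D" using Br.prems by simp
  also have "D \<le> card {u \<in> roots D V E s S1. {v, u} \<in> E i}" by (rule S(7))
  finally obtain u where u: "u \<in> roots D V E s S1" "{v, u} \<in> E i" "u \<notin> X \<union> W2"
    using card_mono[of "X \<union> W2" "{u \<in> roots D V E s S1. {v, u} \<in> E i}"] Br.prems(5) b2 by fastforce
  have "card (X \<union> W2) + tree_size s < D"
    using card_Un_le[of X W2] b2 Br.prems by simp
  then obtain W1 F1 \<psi>1 where 1: "realizes s u W1 F1" "W1 \<subseteq> V" "W1 \<inter> (X \<union> W2) = {}" "inj_on \<psi>1 F1"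
    "\<psi>1 ` F1 \<subseteq> S1" "\<forall>e\<in>F1. e \<in> E (\<psi>1 e)"
    using Br.IH(1)[of u S1 "X \<union> W2"] Br.prems(1,5) u S fin b2 by auto
  note b1 = realizes_basic[OF 1(1)]
  have F: "F1 \<subseteq> Pow W1" "F2 \<subseteq> Pow W2" "{} \<notin> F1" using b1 b2 by (auto simp: nsets_def)
  have F12: "F1 \<inter> F2 = {}"
  proof (rule ccontr)
    assume "F1 \<inter> F2 \<noteq> {}"
    then obtain e where e: "e \<in> F1" "e \<in> F2" by auto
    then have "e \<subseteq> W1 \<inter> W2" using F by auto
    then have "e = {}" using 1(3) by auto
    then show False using e F(3) by simp
  qed
  have new: "{v, u} \<notin> F1" "{v, u} \<notin> F2" using F b1 b2 1(3) u by auto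
  define \<psi> where "\<psi> e = (if e = {v, u} then i else if e \<in> F1 then \<psi>1 e else \<psi>2 e)" for e
  have \<psi>: "\<psi> {v, u} = i" "\<And>e. e \<in> F1 \<Longrightarrow> \<psi> e = \<psi>1 e" "\<And>e. e \<in> F2 \<Longrightarrow> \<psi> e = \<psi>2 e"
    using F12 new by (auto simp: \<psi>_def)
  have im: "\<psi> ` F1 \<subseteq> S1" "\<psi> ` F2 \<subseteq> S2" using \<psi> 1(5) 2(5) by auto
  have "inj_on \<psi> F1" "inj_on \<psi> F2"
    using 1(4) 2(4) inj_on_cong[of F1 \<psi> \<psi>1] inj_on_cong[of F2 \<psi> \<psi>2] \<psi> by auto
  moreover have "\<psi> ` F1 \<inter> \<psi> ` F2 = {}" using im S(3) by blast
  ultimately have "inj_on \<psi> (F1 \<union> F2)" by (auto simp: inj_on_Un)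
  moreover have "\<psi> {v, u} \<notin> \<psi> ` (F1 \<union> F2)" using im S(2) \<psi>(1) by auto
  ultimately have "inj_on \<psi> (insert {v, u} (F1 \<union> F2))" by (subst inj_on_insert) auto
  moreover have "realizes (Br s t) v (W1 \<union> W2) (insert {v, u} (F1 \<union> F2))"
    using 1(1,3) 2(1) by (intro realizes.Br) auto
  moreover have "\<forall>e\<in>insert {v, u} (F1 \<union> F2). e \<in> E (\<psi> e)"
    using \<psi> 1(6) 2(6) u(2) by auto
  moreover have "\<psi> ` insert {v, u} (F1 \<union> F2) \<subseteq> S" using im \<psi>(1) S(1) by auto
  moreover have "W1 \<union> W2 \<subseteq> V" "(W1 \<union> W2) \<inter> X = {}" using 1 2 by auto
  ultimately show ?case by blast
qed

text \<open>Deleting the edges in \<open>removed\<close>, of which there are only linearly many, makes the separation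
  hypothesis of \<open>planted\<close> hold exactly for all subtrees of \<open>t0\<close> at once.\<close>

locale clean_system =
  fixes V :: "'v set" and E :: "nat \<Rightarrow> 'v set set" and D :: nat and K :: "nat set" and t0 :: rtree
  assumes finV: "finite V" and finK: "finite K"
begin

definition removed :: "nat \<Rightarrow> ('v \<times> 'v) set" where
  "removed i = {(x, y). \<exists>s\<in>child_subtrees t0. \<exists>S\<in>Pow K. i \<notin> S \<and> card S = tree_size s \<and>
     x \<in> V - roots D V E (Br s Leaf) (insert i S) \<and> y \<in> roots D V E s S}"

text \<open>Both orders are tested because \<open>removed i\<close> is a set of ordered pairs while
  \<open>planted\<close> demands a symmetric matrix.\<close>

definition A :: "nat \<Rightarrow> 'v \<Rightarrow> 'v \<Rightarrow> real" where
  "A i x y = of_bool ({x, y} \<in> E i \<and> (x, y) \<notin> removed i \<and> (y, x) \<notin> removed i)"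

text \<open>A leaf has no colours and no failing vertex. For \<open>Br s t\<close> any split of
  \<open>S\<close> into \<open>S'\<close> and \<open>S2\<close> of the right sizes will do: a vertex
  that is a root for both halves is one for the whole, so the failing sets unite while the two
  bounds add. The half with \<open>S'\<close> is treated by \<open>planted_bound\<close>.\<close>

lemma weight_bound:
  assumes "child_subtrees t \<subseteq> child_subtrees t0" "S \<subseteq> K" "card S = tree_size t" "\<And>x. 0 \<le> p x"
  shows "(\<Sum>i\<in>S. sqrt (block (A i) p V V)) \<le> real (card S) * sum p V - sum p (V - roots D V E t S)"
  using assms
proof (induction t arbitrary: S p)
  case Leaf
  then have "S = {}" using finite_subset[OF _ finK] by auto
  then show ?case by simp
next
  case (Br s t)
  have finS: "finite S" using Br.prems finK finite_subset by auto
  obtain S2 where S2: "S2 \<subseteq> S" "card S2 = tree_size t"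
    using obtain_subset_with_card_n[of "tree_size t" S] Br.prems(3) by auto
  define S' where "S' = S - S2"
  have S': "card S' = Suc (tree_size s)" "S' \<noteq> {}" "finite S'" "S' \<subseteq> K"
  proof -
    show "card S' = Suc (tree_size s)"
      using S2 finS Br.prems(3) by (simp add: S'_def card_Diff_subset finite_subset)
    then show "S' \<noteq> {}" by auto
  qed (use finS Br.prems in \<open>auto simp: S'_def\<close>)
  have fin2: "finite S2" using S2 finS finite_subset by auto
  define B where "B = V - roots D V E (Br s Leaf) S'"
  \<comment> \<open>Here \<open>b i\<close> consists of the vertices failing for \<open>s\<close>
    with colours \<open>S' - {i}\<close>. A pair from \<open>B\<close> to a vertex that does not
    fail is in \<open>removed i\<close>, which gives \<open>sep\<close>.\<close>
  interpret planted V B S' A "\<lambda>i. V - roots D V E s (S' - {i})"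
  proof
    fix i x y assume i: "i \<in> S'" and x: "x \<in> B" and y: "y \<in> V" "y \<notin> V - roots D V E s (S' - {i})"
    have "insert i (S' - {i}) = S'" using i by auto
    then have "(x, y) \<in> removed i"
      unfolding removed_def using i x y S' Br.prems(1)
      by (auto simp: B_def intro!: bexI[of _ s] bexI[of _ "S' - {i}"] simp del: roots.simps)
    then show "A i x y = 0" by (simp add: A_def)
  next
    fix p :: "'v \<Rightarrow> real" and i assume p: "\<And>x. 0 \<le> p x" and i: "i \<in> S'"
    have "(\<Sum>j\<in>S' - {i}. sqrt (block (A j) p V V))
        \<le> real (card (S' - {i})) * sum p V - sum p (V - roots D V E s (S' - {i}))"
      using Br.prems(1) S' i p by (intro Br.IH(1)) auto
    moreover have "V \<inter> (V - roots D V E s (S' - {i})) = V - roots D V E s (S' - {i})" by auto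
    ultimately show "(\<Sum>j\<in>S' - {i}. sqrt (block (A j) p V V))
        \<le> (real (card S') - 1) * sum p V - sum p (V \<inter> (V - roots D V E s (S' - {i})))"
      using S' i by simp
  qed (auto simp: A_def finV S' B_def insert_commute)
  have 1: "(\<Sum>i\<in>S'. sqrt (block (A i) p V V)) \<le> real (card S') * sum p V - sum p B"
    using planted_bound[of p] S' Br.prems(4) by simp
  have 2: "(\<Sum>i\<in>S2. sqrt (block (A i) p V V)) \<le> real (card S2) * sum p V - sum p (V - roots D V E t S2)"
    using Br.prems S2 by (intro Br.IH(2)) auto
  have "v \<in> roots D V E (Br s t) S" if "v \<in> roots D V E (Br s Leaf) S'" "v \<in> roots D V E t S2" for v
  proof -
    obtain i S1 where *: "S' = insert i S1" "i \<notin> S1" "card S1 = tree_size s"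
      "D \<le> card {u \<in> roots D V E s S1. {v, u} \<in> E i}" "v \<in> V"
    proof -
      obtain i S1 S3 where "S' = insert i (S1 \<union> S3)" "i \<notin> S1 \<union> S3" "card S1 = tree_size s"
        "card S3 = 0" "D \<le> card {u \<in> roots D V E s S1. {v, u} \<in> E i}" "v \<in> V"
        using \<open>v \<in> roots D V E (Br s Leaf) S'\<close> by auto
      moreover from this have "S3 = {}" using S'(3) by (auto simp: card_eq_0_iff)
      ultimately show ?thesis using that by auto
    qed
    have "S = insert i (S1 \<union> S2)" "i \<notin> S1 \<union> S2" "S1 \<inter> S2 = {}"
      using *(1,2) S2(1) by (auto simp: S'_def)
    then show ?thesis using * S2(2) that(2) by auto
  qed
  then have "V - roots D V E (Br s t) S \<subseteq> B \<union> (V - roots D V E t S2)" by (auto simp only: B_def Diff_iff)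
  then have "sum p (V - roots D V E (Br s t) S) \<le> sum p (B \<union> (V - roots D V E t S2))"
    using Br.prems(4) finV by (intro sum_mono2) (auto simp: B_def)
  also have "\<dots> \<le> sum p B + sum p (V - roots D V E t S2)"
    using Br.prems(4) finV by (simp add: sum_Un B_def sum_nonneg)
  finally have 3: "sum p (V - roots D V E (Br s t) S) \<le> sum p B + sum p (V - roots D V E t S2)" .
  have S12: "S = S' \<union> S2" "S' \<inter> S2 = {}" using S2 by (auto simp: S'_def)
  have "(\<Sum>i\<in>S. sqrt (block (A i) p V V))
      = (\<Sum>i\<in>S'. sqrt (block (A i) p V V)) + (\<Sum>i\<in>S2. sqrt (block (A i) p V V))"
    unfolding S12(1) using S' fin2 S12(2) by (intro sum.union_disjoint) auto
  moreover have "card S = card S' + card S2"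
    unfolding S12(1) using S' fin2 S12(2) by (intro card_Un_disjoint) auto
  ultimately show ?case using 1 2 3 by (simp only: of_nat_add distrib_right)
qed

text \<open>For fixed \<open>s\<close> and \<open>S\<close>, a vertex that fails for
  \<open>Br s Leaf\<close> with \<open>insert i S\<close> has fewer than \<open>D\<close> neighbours
  of colour \<open>i\<close> among the roots of \<open>s\<close>, by \<open>roots_BrI\<close>. The
  other factors bound the number of pairs \<open>(s, S)\<close>.\<close>

lemma removed_degree:
  assumes "i \<in> K" "x \<in> V"
  shows "card {y \<in> V. {x, y} \<in> E i \<and> (x, y) \<in> removed i} \<le> card (child_subtrees t0) * 2 ^ card K * D"
proof -
  define I where "I = {(s, S). s \<in> child_subtrees t0 \<and> S \<in> Pow K \<and> i \<notin> S \<and> card S = tree_size s \<and>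
    x \<in> V - roots D V E (Br s Leaf) (insert i S)}"
  define N where "N = (\<lambda>(s, S). {y \<in> roots D V E s S. {x, y} \<in> E i})"
  have I: "I \<subseteq> child_subtrees t0 \<times> Pow K" by (auto simp: I_def simp del: roots.simps)
  have finP: "finite (child_subtrees t0 \<times> Pow K)" using finK finite_child_subtrees by auto
  have finN: "finite (N j)" for j
    unfolding N_def by (auto split: prod.split intro: finite_subset[OF _ finV] dest: subsetD[OF roots_subset])
  have cN: "card (N j) \<le> D" if "j \<in> I" for j
  proof (rule ccontr)
    assume n: "\<not> card (N j) \<le> D"
    obtain s S where j: "j = (s, S)" by force
    then have "S \<subseteq> K" "i \<notin> S" "card S = tree_size s" "x \<notin> roots D V E (Br s Leaf) (insert i S)"
      using that by (auto simp: I_def simp del: roots.simps)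
    moreover have "D \<le> card {u \<in> roots D V E s S. {x, u} \<in> E i}" using n by (simp add: N_def j)
    ultimately show False using roots_BrI[of x V i S s D E] assms(2) by blast
  qed
  have "{y \<in> V. {x, y} \<in> E i \<and> (x, y) \<in> removed i} \<subseteq> (\<Union>j\<in>I. N j)"
  proof
    fix y assume "y \<in> {y \<in> V. {x, y} \<in> E i \<and> (x, y) \<in> removed i}"
    then have "{x, y} \<in> E i" "(x, y) \<in> removed i" by auto
    then obtain s S where "(s, S) \<in> I" "y \<in> roots D V E s S"
      unfolding removed_def I_def by (auto simp del: roots.simps)
    then show "y \<in> (\<Union>j\<in>I. N j)" using \<open>{x, y} \<in> E i\<close> by (intro UN_I[of "(s, S)"]) (auto simp: N_def)
  qed
  then have "card {y \<in> V. {x, y} \<in> E i \<and> (x, y) \<in> removed i} \<le> card (\<Union>j\<in>I. N j)"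
    using finite_subset[OF I finP] finN by (intro card_mono) auto
  also have "\<dots> \<le> (\<Sum>j\<in>I. card (N j))" using finite_subset[OF I finP] by (rule card_UN_le)
  also have "\<dots> \<le> card I * D" using sum_bounded_above[of I "\<lambda>j. card (N j)" D] cN by simp
  also have "\<dots> \<le> card (child_subtrees t0 \<times> Pow K) * D" using card_mono[OF finP I] by simp
  also have "card (child_subtrees t0 \<times> Pow K) = card (child_subtrees t0) * 2 ^ card K"
    using finK by (simp add: card_cartesian_product card_Pow)
  finally show ?thesis .
qed

text \<open>The factor \<open>2\<close> covers removal in either order of a pair; the loss is linear
  in \<open>card V\<close>.\<close>

lemma block_lower_bound:
  assumes "i \<in> K"
  shows "(\<Sum>x\<in>V. \<Sum>y\<in>V. of_bool ({x, y} \<in> E i)) - 2 * real (card (child_subtrees t0) * 2 ^ card K * D) * real (card V)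
    \<le> block (A i) (\<lambda>_. 1) V V"
proof -
  define C where "C = real (card (child_subtrees t0) * 2 ^ card K * D)"
  define r :: "'v \<Rightarrow> 'v \<Rightarrow> real" where "r x y = of_bool ({x, y} \<in> E i \<and> (x, y) \<in> removed i)" for x y
  have "(\<Sum>x\<in>V. \<Sum>y\<in>V. r x y) \<le> (\<Sum>x\<in>V. C)"
  proof (rule sum_mono)
    fix x assume "x \<in> V"
    have "(\<Sum>y\<in>V. r x y) = real (card {y \<in> V. {x, y} \<in> E i \<and> (x, y) \<in> removed i})"
      using finV by (simp add: r_def of_bool_def sum.inter_filter[symmetric])
    also have "\<dots> \<le> C" unfolding C_def using removed_degree[OF assms \<open>x \<in> V\<close>] by (simp only: of_nat_le_iff)
    finally show "(\<Sum>y\<in>V. r x y) \<le> C" .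
  qed
  then have r: "(\<Sum>x\<in>V. \<Sum>y\<in>V. r x y) \<le> C * card V" by (simp add: mult.commute)
  have "(\<Sum>x\<in>V. \<Sum>y\<in>V. of_bool ({x, y} \<in> E i)) \<le> (\<Sum>x\<in>V. \<Sum>y\<in>V. A i x y + r x y + r y x)"
    by (intro sum_mono) (auto simp: A_def r_def insert_commute)
  also have "\<dots> = block (A i) (\<lambda>_. 1) V V + (\<Sum>x\<in>V. \<Sum>y\<in>V. r x y) + (\<Sum>x\<in>V. \<Sum>y\<in>V. r y x)"
    by (simp add: block_def sum.distrib)
  also have "(\<Sum>x\<in>V. \<Sum>y\<in>V. r y x) = (\<Sum>x\<in>V. \<Sum>y\<in>V. r x y)" by (rule sum.swap)
  finally show ?thesis using r by (simp add: C_def)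
qed

end

lemma sum_adjacency:
  assumes "finite V" "F \<subseteq> nsets V 2"
  shows "(\<Sum>x\<in>V. \<Sum>y\<in>V. of_bool ({x, y} \<in> F)) = (2 * real (card F))"
proof -
  have finF: "finite F" using assms finite_subset[OF _ finite_imp_finite_nsets] by blast
  have "(\<Sum>x\<in>V. \<Sum>y\<in>V. of_bool ({x, y} \<in> F)) = (\<Sum>x\<in>V. \<Sum>y\<in>V. \<Sum>e\<in>F. of_bool ({x, y} = e) :: real)"
    using finF by (intro sum.cong refl) (simp add: of_bool_def sum.delta)
  also have "\<dots> = (\<Sum>e\<in>F. \<Sum>x\<in>V. \<Sum>y\<in>V. of_bool ({x, y} = e))"
    by (subst (2) sum.swap, subst sum.swap) (rule refl)
  also have "\<dots> = (\<Sum>e\<in>F. 2)"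
  proof (rule sum.cong[OF refl])
    fix e assume "e \<in> F"
    then obtain u v where e: "e = {u, v}" "u \<noteq> v" "u \<in> V" "v \<in> V"
      using assms(2) by (auto simp: nsets_def card_2_iff)
    have "(\<Sum>y\<in>V. of_bool ({x, y} = e)) = (of_bool (x = u) + of_bool (x = v) :: real)" for x
    proof -
      have "(of_bool ({x, y} = e) :: real) = of_bool (x = u) * of_bool (v = y) + of_bool (x = v) * of_bool (u = y)" for y
        using e by (auto simp: doubleton_eq_iff)
      then show ?thesis
        using assms(1) e by (simp add: sum.distrib of_bool_def sum.delta' flip: sum_distrib_left)
    qed
    then show "(\<Sum>x\<in>V. \<Sum>y\<in>V. of_bool ({x, y} = e)) = (2 :: real)"
      using assms(1) e by (simp add: sum.distrib of_bool_def sum.delta)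
  qed
  finally show ?thesis by simp
qed

text \<open>Without a rainbow copy every vertex fails, so \<open>weight_bound\<close> with unit
  weights bounds the sum of the square roots by \<open>(k - 1) * card V\<close>, and some colour is
  at most the average.\<close>

lemma rainbow_free_min_edges:
  assumes "finite V" "graph_system k V G" "rainbow_free k V G H"
    and "realizes t w (verts H) (edges H)" "tree_size t = k" "k \<ge> 1"
  shows "\<exists>i\<in>{1..k}. 2 * real (card (edges (G i))) \<le> ((real k - 1) / real k)\<^sup>2 * (real (card V))\<^sup>2
    + 2 * real (card (child_subtrees t) * 2 ^ k * Suc k) * real (card V)"
proof -
  define E where "E i = edges (G i)" for i
  \<comment> \<open>\<open>Suc k\<close> is the least \<open>D\<close> that
    \<open>roots_embed\<close> accepts for \<open>k\<close> edges and empty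
    \<open>X\<close>.\<close>
  interpret clean_system V E "Suc k" "{1..k}" t by standard (use assms in auto)
  have no_root: "roots (Suc k) V E t {1..k} = {}"
  proof (rule ccontr)
    assume "\<not> ?thesis"
    then obtain v where "v \<in> roots (Suc k) V E t {1..k}" by auto
    then obtain W F \<psi> where 1: "realizes t v W F" "W \<subseteq> V" "inj_on \<psi> F" "\<psi> ` F \<subseteq> {1..k}" "\<forall>e\<in>F. e \<in> E (\<psi> e)"
      using roots_embed[of V v "Suc k" E t "{1..k}" "{}"] assms by auto
    have "graph_iso (W, F) H" using realizes_iso[of t v "(W, F)" w H] 1(1) assms(4) by simp
    moreover have "rainbow_subgraph k V G (W, F)"
      unfolding rainbow_subgraph_def simple_graph_def
      using 1 realizes_basic[OF 1(1)] by (auto simp: E_def)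
    ultimately show False using assms(3) by (auto simp: rainbow_free_def)
  qed
  define n where "n = real (card V)"
  have "(\<Sum>i\<in>{1..k}. sqrt (block (A i) (\<lambda>_. 1) V V)) \<le> real k * n - n"
    using weight_bound[of t "{1..k}" "\<lambda>_. 1"] assms(5) no_root by (simp add: n_def)
  also have "\<dots> = real (card {1..k}) * ((real k - 1) / real k * n)"
    using assms(6) by (simp add: field_simps)
  finally obtain i where i: "i \<in> {1..k}" "sqrt (block (A i) (\<lambda>_. 1) V V) \<le> (real k - 1) / real k * n"
    using sum_strict_mono[of "{1..k}" "\<lambda>_. (real k - 1) / real k * n" "\<lambda>i. sqrt (block (A i) (\<lambda>_. 1) V V)"]
      assms(6) by (force simp: not_le)
  have "block (A i) (\<lambda>_. 1) V V \<le> ((real k - 1) / real k * n)\<^sup>2"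
    using i(2) by (rule sqrt_le_D)
  moreover have "2 * real (card (edges (G i))) = (\<Sum>x\<in>V. \<Sum>y\<in>V. of_bool ({x, y} \<in> E i))"
    using assms(1,2) i(1) by (subst sum_adjacency) (auto simp: E_def graph_system_def simple_graph_def)
  ultimately show ?thesis
    using block_lower_bound[OF i(1)] i(1) unfolding n_def power_mult_distrib
    by (intro bexI[of _ i]) simp_all
qed

section \<open>Densities of induced subsystems\<close>

definition induced :: "'v set set \<Rightarrow> 'v set \<Rightarrow> 'v set set" where
  "induced F W = {e \<in> F. e \<subseteq> W}"

definition density :: "'v set set \<Rightarrow> 'v set \<Rightarrow> real" where
  "density F W = real (card (induced F W)) / real (card W choose 2)"

lemma induced_subset_nsets: "F \<subseteq> nsets V 2 \<Longrightarrow> induced F W \<subseteq> nsets W 2"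
  by (auto simp: induced_def nsets_def)

lemma finite_induced: "F \<subseteq> nsets V 2 \<Longrightarrow> finite W \<Longrightarrow> finite (induced F W)"
  using finite_subset[OF induced_subset_nsets finite_imp_finite_nsets] by blast

lemma card_induced_le: "F \<subseteq> nsets V 2 \<Longrightarrow> finite W \<Longrightarrow> card (induced F W) \<le> card W choose 2"
  by (metis card_mono card_nsets finite_imp_finite_nsets induced_subset_nsets)

text \<open>Double counting: an edge survives the deletion of each of the \<open>card W - 2\<close>
  vertices off it.\<close>

lemma sum_card_induced_delete:
  assumes "F \<subseteq> nsets V 2" "finite W"
  shows "(\<Sum>v\<in>W. real (card (induced F (W - {v})))) = (real (card W) - 2) * real (card (induced F W))"
proof -
  note fin = finite_induced[OF assms]
  have "real (card (induced F (W - {v}))) = (\<Sum>e\<in>induced F W. of_bool (v \<notin> e))" if "v \<in> W" for v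
  proof -
    have "induced F (W - {v}) = {e \<in> induced F W. v \<notin> e}" by (auto simp: induced_def)
    then show ?thesis using fin by (simp add: of_bool_def sum.inter_filter[symmetric])
  qed
  then have "(\<Sum>v\<in>W. real (card (induced F (W - {v})))) = (\<Sum>v\<in>W. \<Sum>e\<in>induced F W. of_bool (v \<notin> e))"
    by simp
  also have "\<dots> = (\<Sum>e\<in>induced F W. \<Sum>v\<in>W. of_bool (v \<notin> e))" by (rule sum.swap)
  also have "\<dots> = (\<Sum>e\<in>induced F W. real (card W) - 2)"
  proof (rule sum.cong[OF refl])
    fix e assume "e \<in> induced F W"
    then have e: "e \<subseteq> W" "card e = 2" "finite e" using induced_subset_nsets[OF assms(1), of W] by (auto simp: nsets_def)
    have "(\<Sum>v\<in>W. of_bool (v \<notin> e)) = real (card (W - e))"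
      using assms(2) by (simp add: of_bool_def sum.inter_filter[symmetric] set_diff_eq)
    also have "\<dots> = real (card W) - 2"
      using e assms(2) card_mono[of W e] by (simp add: card_Diff_subset of_nat_diff)
    finally show "(\<Sum>v\<in>W. of_bool (v \<notin> e)) = real (card W) - 2" .
  qed
  finally show ?thesis by (simp add: mult.commute)
qed

lemma card_induced_delete:
  assumes "F \<subseteq> nsets V 2" "finite W" "v \<in> W"
  shows "card (induced F (W - {v})) \<le> card (induced F W)"
    and "card (induced F W) \<le> card (induced F (W - {v})) + (card W - 1)"
proof -
  note fin = finite_induced[OF assms(1,2)]
  show "card (induced F (W - {v})) \<le> card (induced F W)"
    using fin by (intro card_mono) (auto simp: induced_def)
  have "induced F W \<subseteq> induced F (W - {v}) \<union> (\<lambda>u. {v, u}) ` (W - {v})"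
  proof
    fix e assume e: "e \<in> induced F W"
    then have "e \<in> nsets W 2" using induced_subset_nsets[OF assms(1)] by auto
    then obtain a b where "e = {a, b}" "a \<noteq> b" "a \<in> W" "b \<in> W" by (auto simp: nsets_def card_2_iff)
    then show "e \<in> induced F (W - {v}) \<union> (\<lambda>u. {v, u}) ` (W - {v})"
      using e by (auto simp: induced_def)
  qed
  then have "card (induced F W) \<le> card (induced F (W - {v}) \<union> (\<lambda>u. {v, u}) ` (W - {v}))"
    using assms(2) finite_induced[OF assms(1), of "W - {v}"] by (intro card_mono) auto
  also have "\<dots> \<le> card (induced F (W - {v})) + card (W - {v})"
    using card_Un_le[of "induced F (W - {v})" "(\<lambda>u. {v, u}) ` (W - {v})"]
      card_image_le[of "W - {v}" "\<lambda>u. {v, u}"] assms(2) by simp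
  finally show "card (induced F W) \<le> card (induced F (W - {v})) + (card W - 1)"
    using assms by (simp add: card_Diff_singleton)
qed

lemma real_choose_two: "real (n choose 2) = real n * (real n - 1) / 2"
  by (cases n) (simp_all add: choose_two real_of_nat_div algebra_simps)

lemma density_delete:
  assumes "F \<subseteq> nsets V 2" "finite W" "card W \<ge> 3"
  shows "(\<Sum>v\<in>W. density F (W - {v})) = real (card W) * density F W"
    and "v \<in> W \<Longrightarrow> \<bar>density F (W - {v}) - density F W\<bar> \<le> 2 / (real (card W) - 2)"
proof -
  define m where "m = real (card W)"
  have m: "m \<ge> 3" using assms by (simp add: m_def)
  define e where "e = real (card (induced F W))"
  have dW: "density F W = e * (2 / (m * (m - 1)))"
    by (simp add: density_def real_choose_two m_def e_def)
  have dv: "density F (W - {v}) = real (card (induced F (W - {v}))) * (2 / ((m - 1) * (m - 2)))" if "v \<in> W" for v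
    using that assms by (simp add: density_def real_choose_two m_def of_nat_diff)
  have "(\<Sum>v\<in>W. density F (W - {v})) = (m - 2) * e * (2 / ((m - 1) * (m - 2)))"
    using dv sum_card_induced_delete[OF assms(1,2)] by (simp add: m_def e_def flip: sum_distrib_right sum_divide_distrib)
  also have "\<dots> = m * density F W" using m by (simp add: dW)
  finally show "(\<Sum>v\<in>W. density F (W - {v})) = real (card W) * density F W" by (simp add: m_def)
  assume v: "v \<in> W"
  define f where "f = real (card (induced F (W - {v})))"
  have f: "f \<le> e" "e \<le> f + (m - 1)"
    using card_induced_delete[OF assms(1,2) v] assms(3) by (simp_all add: f_def e_def m_def of_nat_diff flip: of_nat_add)
  have e: "0 \<le> e" "e \<le> m * (m - 1) / 2"
    using card_induced_le[OF assms(1,2)] by (simp_all add: e_def m_def flip: real_choose_two)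
  \<comment> \<open>\<open>g\<close> is \<open>1 / ((m - 1) choose 2)\<close>. The loss of edges and
    the smaller denominator change the density in opposite directions, each by at most
    \<open>2 / (m - 2)\<close>.\<close>
  define g where "g = 2 / ((m - 1) * (m - 2))"
  have g: "g \<ge> 0" "g * (m - 1) = 2 / (m - 2)" "2 / (m * (m - 1)) = g - g * (2 / m)"
  proof -
    show "g \<ge> 0" using m by (simp add: g_def)
    have "g * (m - 1) = (m - 1) * 2 / ((m - 1) * (m - 2))" by (simp add: g_def mult.commute)
    also have "\<dots> = 2 / (m - 2)" using m by (intro mult_divide_mult_cancel_left) auto
    finally show "g * (m - 1) = 2 / (m - 2)" .
    have "g - g * (2 / m) = g * ((m - 2) / m)" using m by (simp add: diff_divide_distrib right_diff_distrib)
    also have "\<dots> = 2 * (m - 2) / ((m * (m - 1)) * (m - 2))" by (simp add: g_def mult_ac)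
    also have "\<dots> = 2 / (m * (m - 1))" using m by (intro mult_divide_mult_cancel_right) auto
    finally show "2 / (m * (m - 1)) = g - g * (2 / m)" by simp
  qed
  have "e * (g * (2 / m)) \<le> (m * (m - 1) / 2) * (g * (2 / m))" using e m g by (intro mult_right_mono) auto
  also have "\<dots> = g * (m - 1)" using m by simp
  finally have 1: "e * (g * (2 / m)) \<le> 2 / (m - 2)" using g by simp
  have 2: "0 \<le> e * (g * (2 / m))" using e g m by simp
  have 3: "f * g \<le> e * g" "e * g \<le> f * g + 2 / (m - 2)"
    using f g(1) mult_right_mono[OF f(1) g(1)] mult_right_mono[OF f(2) g(1)] g(2) by (simp_all add: algebra_simps)
  have "density F (W - {v}) - density F W = f * g - e * g + e * (g * (2 / m))"
    unfolding dW dv[OF v] g(3) by (simp add: f_def g_def right_diff_distrib)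
  then show "\<bar>density F (W - {v}) - density F W\<bar> \<le> 2 / (real (card W) - 2)"
    using 1 2 3 by (simp add: m_def[symmetric] abs_le_iff)
qed

text \<open>A single vertex must serve all colours, hence the sum of squares. Averaged over
  \<open>v\<close>, the cross terms vanish by \<open>density_delete(1)\<close> and only the squared
  changes are added; some \<open>v\<close> is no worse than average.\<close>

lemma density_variance_delete:
  assumes "finite I" "\<And>i. i \<in> I \<Longrightarrow> F i \<subseteq> nsets V 2" "finite W" "card W \<ge> 3"
  obtains v where "v \<in> W" "(\<Sum>i\<in>I. (density (F i) (W - {v}) - \<alpha> i)\<^sup>2)
    \<le> (\<Sum>i\<in>I. (density (F i) W - \<alpha> i)\<^sup>2) + real (card I) * (2 / (real (card W) - 2))\<^sup>2"
proof -
  define B where "B = (\<Sum>i\<in>I. (density (F i) W - \<alpha> i)\<^sup>2) + real (card I) * (2 / (real (card W) - 2))\<^sup>2"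
  define \<delta> where "\<delta> i v = density (F i) (W - {v}) - density (F i) W" for i v
  have ne: "W \<noteq> {}" using assms(4) by auto
  have "(\<Sum>v\<in>W. (density (F i) (W - {v}) - \<alpha> i)\<^sup>2)
      \<le> (\<Sum>v\<in>W. (2 / (real (card W) - 2))\<^sup>2 + (density (F i) W - \<alpha> i)\<^sup>2)" if i: "i \<in> I" for i
  proof -
    have "(\<Sum>v\<in>W. \<delta> i v) = 0"
      using density_delete(1)[OF assms(2)[OF i] assms(3,4)] by (simp add: \<delta>_def sum_subtractf)
    moreover have "(density (F i) (W - {v}) - \<alpha> i)\<^sup>2
        = (\<delta> i v)\<^sup>2 + 2 * (density (F i) W - \<alpha> i) * \<delta> i v + (density (F i) W - \<alpha> i)\<^sup>2" for v
      by (simp add: \<delta>_def power2_eq_square algebra_simps)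
    ultimately have "(\<Sum>v\<in>W. (density (F i) (W - {v}) - \<alpha> i)\<^sup>2)
        = (\<Sum>v\<in>W. (\<delta> i v)\<^sup>2 + (density (F i) W - \<alpha> i)\<^sup>2)"
      by (simp add: sum.distrib flip: sum_distrib_left)
    also have "\<dots> \<le> (\<Sum>v\<in>W. (2 / (real (card W) - 2))\<^sup>2 + (density (F i) W - \<alpha> i)\<^sup>2)"
    proof (intro sum_mono add_right_mono)
      fix v assume "v \<in> W"
      then have "\<bar>\<delta> i v\<bar> \<le> 2 / (real (card W) - 2)"
        unfolding \<delta>_def by (rule density_delete(2)[OF assms(2)[OF i] assms(3,4)])
      then show "(\<delta> i v)\<^sup>2 \<le> (2 / (real (card W) - 2))\<^sup>2" by (metis abs_ge_zero power2_abs power_mono)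
    qed
    finally show ?thesis .
  qed
  then have "(\<Sum>i\<in>I. \<Sum>v\<in>W. (density (F i) (W - {v}) - \<alpha> i)\<^sup>2)
      \<le> (\<Sum>i\<in>I. \<Sum>v\<in>W. (2 / (real (card W) - 2))\<^sup>2 + (density (F i) W - \<alpha> i)\<^sup>2)"
    by (rule sum_mono)
  also have "\<dots> = real (card W) * B"
    by (simp add: B_def sum.distrib distrib_left flip: sum_distrib_left)
  finally have le: "(\<Sum>v\<in>W. \<Sum>i\<in>I. (density (F i) (W - {v}) - \<alpha> i)\<^sup>2) \<le> (\<Sum>v\<in>W. B)"
    by (subst sum.swap) simp
  have "\<exists>v\<in>W. (\<Sum>i\<in>I. (density (F i) (W - {v}) - \<alpha> i)\<^sup>2) \<le> B"
  proof (rule ccontr)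
    assume "\<not> ?thesis"
    then have "(\<Sum>v\<in>W. B) < (\<Sum>v\<in>W. \<Sum>i\<in>I. (density (F i) (W - {v}) - \<alpha> i)\<^sup>2)"
      using assms(3) ne by (intro sum_strict_mono) (auto simp: not_le)
    then show False using le by simp
  qed
  then show ?thesis using that by (auto simp: B_def)
qed

text \<open>Vertices are deleted one at a time so that the total squared deviation from the initial densities
  grows by at most \<open>4 k / (m - 2)\<^sup>2\<close> at a deletion from \<open>m\<close> vertices; these increments telescope.\<close>

lemma dense_subset:
  assumes "finite I" "\<And>i. i \<in> I \<Longrightarrow> F i \<subseteq> nsets V 2" "finite V" "3 \<le> n" "n \<le> card V"
  obtains W where "W \<subseteq> V" "card W = n"
    "\<And>i. i \<in> I \<Longrightarrow> density (F i) V - sqrt (4 * real (card I) / (real n - 2)) \<le> density (F i) W"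
proof -
  define k where "k = real (card I)"
  have "\<exists>W\<subseteq>V. card W = n \<and> (\<Sum>i\<in>I. (density (F i) W - density (F i) V)\<^sup>2)
      \<le> 4 * k * (1 / (real n - 2) - 1 / (real (card V) - 2))"
    using \<open>n \<le> card V\<close>
  proof (induction n rule: inc_induct)
    case base
    then show ?case by (intro exI[of _ V]) simp
  next
    case (step m)
    then obtain W where W: "W \<subseteq> V" "card W = Suc m" "(\<Sum>i\<in>I. (density (F i) W - density (F i) V)\<^sup>2)
      \<le> 4 * k * (1 / (real (Suc m) - 2) - 1 / (real (card V) - 2))" by blast
    have fW: "finite W" using W(1) assms(3) finite_subset by auto
    have m: "real m \<ge> 3" "card W \<ge> 3" using step(1) assms(4) W(2) by auto
    obtain v where v: "v \<in> W" "(\<Sum>i\<in>I. (density (F i) (W - {v}) - density (F i) V)\<^sup>2)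
      \<le> (\<Sum>i\<in>I. (density (F i) W - density (F i) V)\<^sup>2) + k * (2 / (real (card W) - 2))\<^sup>2"
      using density_variance_delete[where F = F and \<alpha> = "\<lambda>i. density (F i) V", OF assms(1) assms(2) fW m(2)] unfolding k_def by blast
    \<comment> \<open>Here \<open>card W = Suc m\<close>. Weakening one factor \<open>m - 1\<close>
      to \<open>m - 2\<close> turns the increment into a difference that telescopes.\<close>
    have "(2 / (real (card W) - 2))\<^sup>2 = 4 * (1 / (real m - 1)\<^sup>2)"
      using W(2) by (simp add: power_divide)
    also have "1 / (real m - 1)\<^sup>2 \<le> 1 / ((real m - 1) * (real m - 2))"
      using m(1) unfolding power2_eq_square by (intro divide_left_mono mult_left_mono mult_pos_pos) auto
    also have "\<dots> = 1 / (real m - 2) - 1 / (real m - 1)"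
      using m(1) by (simp add: field_simps)
    finally have "k * (2 / (real (card W) - 2))\<^sup>2 \<le> k * (4 * (1 / (real m - 2) - 1 / (real m - 1)))"
      by (intro mult_left_mono) (auto simp: k_def)
    also have "\<dots> = 4 * k * (1 / (real m - 2) - 1 / (real m - 1))" by simp
    finally have "(\<Sum>i\<in>I. (density (F i) (W - {v}) - density (F i) V)\<^sup>2)
      \<le> 4 * k * (1 / (real m - 2) - 1 / (real (card V) - 2))"
      using v(2) W(3) by (simp add: right_diff_distrib)
    moreover have "card (W - {v}) = m" using v(1) W(2) fW by simp
    ultimately show ?case using W(1) by (intro exI[of _ "W - {v}"]) auto
  qed
  then obtain W where W: "W \<subseteq> V" "card W = n" "(\<Sum>i\<in>I. (density (F i) W - density (F i) V)\<^sup>2)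
      \<le> 4 * k * (1 / (real n - 2) - 1 / (real (card V) - 2))" by blast
  have "density (F i) V - sqrt (4 * k / (real n - 2)) \<le> density (F i) W" if "i \<in> I" for i
  proof -
    have "(density (F i) W - density (F i) V)\<^sup>2 \<le> (\<Sum>i\<in>I. (density (F i) W - density (F i) V)\<^sup>2)"
      using that assms(1) by (intro member_le_sum[of i I "\<lambda>i. (density (F i) W - density (F i) V)\<^sup>2"]) auto
    also note W(3)
    also have "4 * k * (1 / (real n - 2) - 1 / (real (card V) - 2)) \<le> 4 * k * (1 / (real n - 2))"
      using assms(4,5) by (intro mult_left_mono) (auto simp: k_def)
    finally have "\<bar>density (F i) W - density (F i) V\<bar> \<le> sqrt (4 * k / (real n - 2))"
      by (intro real_le_rsqrt) simp
    then show ?thesis by simp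
  qed
  with W that show ?thesis by (simp add: k_def)
qed

text \<open>Past a term that is within \<open>e / 2\<close> of the infimum of a tail and has
  \<delta> below \<open>e / 2\<close>, all values lie in an interval of length
  \<open>e\<close>.\<close>

lemma convergent_almost_decreasing:
  fixes a \<delta> :: "nat \<Rightarrow> real"
  assumes "\<And>n. 0 \<le> a n" "\<delta> \<longlonglongrightarrow> 0" "\<And>n m. n0 \<le> n \<Longrightarrow> n \<le> m \<Longrightarrow> a m \<le> a n + \<delta> n"
  shows "convergent a"
proof (rule real_Cauchy_convergent, rule metric_CauchyI)
  fix e :: real assume e: "0 < e"
  obtain n1 where n1: "\<And>n. n \<ge> n1 \<Longrightarrow> \<bar>\<delta> n\<bar> < e / 2"
    using LIMSEQ_D[OF assms(2), of "e / 2"] e by auto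
  define X where "X = a ` {max n0 n1..}"
  have bdd: "bdd_below X" unfolding X_def using assms(1) by (intro bdd_belowI[of _ 0]) auto
  obtain x where "x \<in> X" "x < Inf X + e / 2"
    using cInf_lessD[of X "Inf X + e / 2"] e by (auto simp: X_def)
  then obtain M where M: "M \<ge> n0" "M \<ge> n1" "a M < Inf X + e / 2" by (auto simp: X_def)
  have "Inf X \<le> a m" "a m < Inf X + e" if "m \<ge> M" for m
  proof -
    show "Inf X \<le> a m" using M that by (intro cInf_lower bdd) (auto simp: X_def)
    show "a m < Inf X + e" using assms(3)[of M m] n1[of M] M that by simp
  qed
  then show "\<exists>M. \<forall>m\<ge>M. \<forall>n\<ge>M. dist (a m) (a n) < e"
    by (intro exI[of _ M]) (smt (verit) dist_real_def)
qed

section \<open>The rainbow Turan densities\<close>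

abbreviation ex_values :: "nat \<Rightarrow> nat \<Rightarrow> 'b ugraph \<Rightarrow> nat set" where
  "ex_values k n H \<equiv> {Min ((\<lambda>i. card (edges (G i))) ` {1..k}) | G.
     graph_system k {1..n} G \<and> rainbow_free k {1..n} G H}"

lemma graph_system_edges: "graph_system k V G \<Longrightarrow> i \<in> {1..k} \<Longrightarrow> edges (G i) \<subseteq> nsets V 2"
  unfolding graph_system_def simple_graph_def by metis

lemma rainbow_subgraphE:
  assumes "rainbow_subgraph k V G H"
  obtains \<psi> where "simple_graph H" "verts H \<subseteq> V" "inj_on \<psi> (edges H)" "\<psi> ` edges H \<subseteq> {1..k}"
    "\<forall>e\<in>edges H. e \<in> edges (G (\<psi> e))"
  using assms unfolding rainbow_subgraph_def by (elim conjE exE) (rule that)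

lemma image_nsets_subset:
  assumes "inj_on f W" "F \<subseteq> nsets W r"
  shows "(`) f ` F \<subseteq> nsets (f ` W) r"
proof (rule image_subsetI)
  fix e assume "e \<in> F"
  then have "e \<subseteq> W" "finite e" "card e = r" using assms(2) by (auto simp: nsets_def)
  then show "f ` e \<in> nsets (f ` W) r"
    using card_image[OF inj_on_subset[OF assms(1)], of e] by (simp add: nsets_def image_mono)
qed

lemma graph_system_card_edges_le:
  assumes "graph_system k {1..n} G" "i \<in> {1..k}"
  shows "card (edges (G i)) \<le> n choose 2"
proof -
  have "edges (G i) \<subseteq> nsets {1..n} 2" by (rule graph_system_edges[OF assms])
  then have "card (edges (G i)) \<le> card (nsets {1..n} 2)"
    by (intro card_mono finite_imp_finite_nsets) auto
  then show ?thesis by simp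
qed

lemma ex_values_le: "m \<in> ex_values k n H \<Longrightarrow> k \<ge> 1 \<Longrightarrow> m \<le> n choose 2"
proof -
  assume "m \<in> ex_values k n H" "k \<ge> 1"
  then obtain G where G: "graph_system k {1..n} G" "m = Min ((\<lambda>i. card (edges (G i))) ` {1..k})" by auto
  have "m \<le> card (edges (G 1))" unfolding G(2) using \<open>k \<ge> 1\<close> by (intro Min_le) auto
  also have "\<dots> \<le> n choose 2" using graph_system_card_edges_le[OF G(1), of 1] \<open>k \<ge> 1\<close> by simp
  finally show ?thesis .
qed

lemma finite_ex_values: "k \<ge> 1 \<Longrightarrow> finite (ex_values k n H)"
  by (rule finite_subset[of _ "{..n choose 2}"])
    (intro subsetI iffD2[OF atMost_iff] ex_values_le, assumption+, rule finite_atMost)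

lemma ex_star_ge:
  assumes "graph_system k {1..n} G" "rainbow_free k {1..n} G H" "k \<ge> 1"
    and "\<And>i. i \<in> {1..k} \<Longrightarrow> m \<le> card (edges (G i))"
  shows "m \<le> ex_star k n H"
proof -
  have "m \<le> Min ((\<lambda>i. card (edges (G i))) ` {1..k})" using assms(3,4) by (subst Min_ge_iff) auto
  also have "\<dots> \<le> ex_star k n H"
    unfolding ex_star_def using assms(1,2) by (intro Max_ge finite_ex_values assms(3)) blast
  finally show ?thesis .
qed

lemma edgeless_rainbow_free:
  assumes "simple_graph H" "edges H \<noteq> {}"
  shows "rainbow_free k V (\<lambda>_. (V, {})) H"
proof (unfold rainbow_free_def, rule notI, elim exE conjE)
  fix H' assume H': "rainbow_subgraph k V (\<lambda>_. (V, {})) H'" "graph_iso H' H"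
  then have "edges H' = {}" "simple_graph H'" unfolding rainbow_subgraph_def snd_conv by blast+
  obtain f where "bij_betw f (verts H') (verts H)" "edges H = (`) f ` edges H'"
    by (rule graph_isoE[OF H'(2) \<open>simple_graph H'\<close> assms(1)])
  then show False using assms(2) \<open>edges H' = {}\<close> by simp
qed

lemma ex_star_attained:
  assumes "simple_graph H" "edges H \<noteq> {}" "k \<ge> 1"
  obtains G where "graph_system k {1..n} G" "rainbow_free k {1..n} G H"
    "\<And>i. i \<in> {1..k} \<Longrightarrow> ex_star k n H \<le> card (edges (G i))"
proof -
  have "graph_system k {1..n} (\<lambda>_. ({1..n}, {}))" by (auto simp: graph_system_def simple_graph_def)
  then have "ex_values k n H \<noteq> {}" using edgeless_rainbow_free[OF assms(1,2)] by blast
  then have "ex_star k n H \<in> ex_values k n H"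
    unfolding ex_star_def by (rule Max_in[OF finite_ex_values[OF assms(3)]])
  then obtain G where G: "graph_system k {1..n} G" "rainbow_free k {1..n} G H"
    "ex_star k n H = Min ((\<lambda>i. card (edges (G i))) ` {1..k})" by blast
  have "ex_star k n H \<le> card (edges (G i))" if "i \<in> {1..k}" for i
    unfolding G(3) using that by (intro Min_le) auto
  then show ?thesis using that G by blast
qed

text \<open>A rainbow copy in the relabelled system is pulled back along the inverse
  \<open>g\<close> of \<open>f\<close>, each edge keeping its colour.\<close>

lemma rainbow_free_induced_image:
  assumes "rainbow_free k V G H" "W \<subseteq> V" "bij_betw f W U" "simple_graph H"
  shows "rainbow_free k U (\<lambda>i. (U, (`) f ` induced (edges (G i)) W)) H"
proof (unfold rainbow_free_def, rule notI, elim exE conjE)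
  fix H' assume H': "rainbow_subgraph k U (\<lambda>i. (U, (`) f ` induced (edges (G i)) W)) H'" "graph_iso H' H"
  obtain \<psi> where \<psi>: "simple_graph H'" "verts H' \<subseteq> U" "inj_on \<psi> (edges H')" "\<psi> ` edges H' \<subseteq> {1..k}"
    "\<forall>e\<in>edges H'. e \<in> (`) f ` induced (edges (G (\<psi> e))) W"
    by (rule rainbow_subgraphE[OF H'(1), unfolded snd_conv])
  obtain h where h: "bij_betw h (verts H') (verts H)" "edges H = (`) h ` edges H'"
    by (rule graph_isoE[OF H'(2) \<psi>(1) assms(4)])
  define g where "g = inv_into W f"
  have gf: "g ` f ` e = e" if "e \<subseteq> W" for e
    using that assms(3) unfolding g_def by (simp add: bij_betw_def inv_into_image_cancel)
  have fg: "f (g x) = x" if "x \<in> U" for x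
    using that assms(3) unfolding g_def by (meson bij_betw_inv_into_right)
  have gW: "g x \<in> W" if "x \<in> U" for x
    using that assms(3) unfolding g_def by (metis bij_betw_def inv_into_into)
  have eU: "e \<subseteq> U" if "e \<in> edges H'" for e
    using \<psi>(1,2) that by (auto simp: simple_graph_def nsets_def)
  have fge: "f ` g ` e = e" if "e \<in> edges H'" for e
    using eU[OF that] fg by (force simp: image_image)
  have ge: "g ` e \<in> edges (G (\<psi> e))" if "e \<in> edges H'" for e
    using \<psi>(5) that gf by (auto simp: induced_def)
  have inj_g: "inj_on g U" using fg by (rule inj_on_inverseI)
  define H2 where "H2 = (g ` verts H', (`) g ` edges H')"
  have s2: "simple_graph H2"
    using \<psi>(1) image_nsets_subset[OF inj_on_subset[OF inj_g \<psi>(2)], of "edges H'" 2]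
    by (simp add: simple_graph_def H2_def)
  have "rainbow_subgraph k V G H2"
    unfolding rainbow_subgraph_def
  proof (intro conjI exI[of _ "\<lambda>e. \<psi> (f ` e)"])
    show "verts H2 \<subseteq> V" using gW \<psi>(2) assms(2) by (auto simp: H2_def)
    show "inj_on (\<lambda>e. \<psi> (f ` e)) (edges H2)"
      using \<psi>(3) fge by (auto simp: H2_def inj_on_def)
    show "(\<lambda>e. \<psi> (f ` e)) ` edges H2 \<subseteq> {1..k}" using \<psi>(4) fge by (auto simp: H2_def)
    show "\<forall>e\<in>edges H2. e \<in> edges (G (\<psi> (f ` e)))" using ge fge by (auto simp: H2_def)
  qed (rule s2)
  moreover have "graph_iso H2 H"
  proof (rule graph_isoI)
    have "bij_betw f (g ` verts H') (verts H')"
      by (rule bij_betw_byWitness[of _ g]) (use fg \<psi>(2) in auto)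
    then show "bij_betw (h \<circ> f) (verts H2) (verts H)"
      using h(1) by (auto simp: H2_def intro: bij_betw_trans)
    have "(\<lambda>e. (h \<circ> f) ` g ` e) ` edges H' = (`) h ` edges H'"
      by (rule image_cong[OF refl]) (simp only: image_comp[symmetric] fge)
    then show "edges H = (`) (h \<circ> f) ` edges H2"
      by (simp only: h(2) H2_def snd_conv image_image[of "(`) (h \<circ> f)" "(`) g"])
    show "edges H2 \<subseteq> Pow (verts H2)" using s2 by (auto simp: simple_graph_def nsets_def)
  qed
  ultimately show False using assms(1) unfolding rainbow_free_def by blast
qed

text \<open>An extremal system on \<open>m\<close> vertices is restricted to \<open>n\<close> of
  them and relabelled. Averaging alone secures a good subset for one colour at a time; the square
  root, from \<open>dense_subset\<close>, is the price of one subset for all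
  \<open>k\<close>.\<close>

lemma ex_star_density_almost_decreasing:
  assumes "simple_graph H" "edges H \<noteq> {}" "k \<ge> 1" "3 \<le> n" "n \<le> m"
  shows "real (ex_star k m H) / real (m choose 2)
    \<le> real (ex_star k n H) / real (n choose 2) + sqrt (4 * real k / (real n - 2))"
proof -
  define d where "d = real (ex_star k m H) / real (m choose 2) - sqrt (4 * real k / (real n - 2))"
  obtain G where G: "graph_system k {1..m} G" "rainbow_free k {1..m} G H"
    "\<And>i. i \<in> {1..k} \<Longrightarrow> ex_star k m H \<le> card (edges (G i))"
    using ex_star_attained[OF assms(1-3)] by blast
  define F where "F i = edges (G i)" for i
  have F: "F i \<subseteq> nsets {1..m} 2" if "i \<in> {1..k}" for i
    unfolding F_def by (rule graph_system_edges[OF G(1) that])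
  obtain W where W: "W \<subseteq> {1..m}" "card W = n"
    "\<And>i. i \<in> {1..k} \<Longrightarrow> density (F i) {1..m} - sqrt (4 * real (card {1..k}) / (real n - 2)) \<le> density (F i) W"
    by (rule dense_subset[of "{1..k}" F "{1..m}" n]) (use F assms in auto)
  have fW: "finite W" using W(1) finite_subset by auto
  have c2: "real (n choose 2) > 0" using assms(4) by simp
  have dens: "d * real (n choose 2) \<le> real (card (induced (F i) W))" if i: "i \<in> {1..k}" for i
  proof -
    have "induced (F i) {1..m} = F i" using F[OF i] by (auto simp: induced_def nsets_def)
    then have "real (ex_star k m H) / real (m choose 2) \<le> density (F i) {1..m}"
      using G(3)[OF i] by (simp add: density_def F_def divide_right_mono)
    then have "d \<le> density (F i) W" using W(3)[OF i] by (simp add: d_def)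
    then show ?thesis using c2 by (simp add: density_def W(2) pos_le_divide_eq)
  qed
  obtain f where f: "bij_betw f W {1..n}"
    using finite_same_card_bij[OF fW, of "{1..n}"] W(2) by auto
  define G' where "G' i = ({1..n}, (`) f ` induced (edges (G i)) W)" for i
  have cG: "card (edges (G' i)) = card (induced (F i) W)" if "i \<in> {1..k}" for i
  proof -
    have "inj_on ((`) f) (induced (F i) W)"
      using f inj_on_image_Pow[of f W] by (auto simp: bij_betw_def induced_def intro: inj_on_subset)
    then show ?thesis by (simp add: G'_def F_def card_image)
  qed
  have "graph_system k {1..n} G'"
    unfolding graph_system_def
  proof
    fix i assume i: "i \<in> {1..k}"
    have "induced (F i) W \<subseteq> nsets W 2" using F[OF i] by (rule induced_subset_nsets)
    then have "(`) f ` induced (F i) W \<subseteq> nsets {1..n} 2"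
      using f image_nsets_subset[of f W] unfolding bij_betw_def by metis
    then show "simple_graph (G' i) \<and> verts (G' i) = {1..n}" by (simp add: simple_graph_def G'_def F_def)
  qed
  moreover have "rainbow_free k {1..n} G' H"
    unfolding G'_def using G(2) W(1) f assms(1) by (rule rainbow_free_induced_image)
  ultimately have ge: "\<And>q. (\<And>i. i \<in> {1..k} \<Longrightarrow> q \<le> card (edges (G' i))) \<Longrightarrow> q \<le> ex_star k n H"
    using ex_star_ge assms(3) by blast
  \<comment> \<open>\<open>ex_star_ge\<close> takes a natural number. Rounding up is harmless
    because edge counts are integers, and \<open>nat\<close> covers a negative
    \<open>d\<close>.\<close>
  have "nat \<lceil>d * real (n choose 2)\<rceil> \<le> ex_star k n H"
    by (rule ge) (use dens cG in \<open>simp add: nat_le_iff ceiling_le_iff\<close>)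
  then have "d * real (n choose 2) \<le> real (ex_star k n H)" by linarith
  then have "d \<le> real (ex_star k n H) / real (n choose 2)" using c2 by (simp add: pos_le_divide_eq)
  then show ?thesis by (simp add: d_def)
qed

text \<open>Makes the \<open>lim\<close> in \<open>pi_star\<close> a genuine limit, so that bounds
  for each \<open>n\<close> pass to \<open>pi_star\<close>.\<close>

lemma ex_star_density_tendsto_pi_star:
  assumes "simple_graph H" "edges H \<noteq> {}" "k \<ge> 1"
  shows "(\<lambda>n. real (ex_star k n H) / real (n choose 2)) \<longlonglongrightarrow> pi_star k H"
proof -
  have "(\<lambda>n. sqrt (4 * real k * inverse (real (Suc n)))) \<longlonglongrightarrow> sqrt (4 * real k * 0)"
    by (intro tendsto_intros LIMSEQ_inverse_real_of_nat)
  then have "(\<lambda>n. sqrt (4 * real k / (real (n + 3) - 2))) \<longlonglongrightarrow> 0"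
    by (simp add: divide_inverse add.commute)
  then have "(\<lambda>n. sqrt (4 * real k / (real n - 2))) \<longlonglongrightarrow> 0" by (rule LIMSEQ_offset)
  then have "convergent (\<lambda>n. real (ex_star k n H) / real (n choose 2))"
    using ex_star_density_almost_decreasing[OF assms] by (intro convergent_almost_decreasing[where ?n0.0 = 3]) auto
  then show ?thesis unfolding pi_star_def by (simp add: convergent_LIMSEQ_iff)
qed

lemma quadratic_ratio_tendsto:
  "(\<lambda>n. (c * (real n)\<^sup>2 + b * real n) / (2 * real (n choose 2))) \<longlonglongrightarrow> c"
proof -
  have "(\<lambda>n. c + (c + b) * inverse (real (Suc n))) \<longlonglongrightarrow> c + (c + b) * 0"
    by (intro tendsto_intros LIMSEQ_inverse_real_of_nat)
  \<comment> \<open>Shifting the index by \<open>2\<close> keeps the binomial coefficient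
    nonzero.\<close>
  moreover have "c + (c + b) * inverse (real (Suc n))
      = (c * (real (n + 2))\<^sup>2 + b * real (n + 2)) / (2 * real ((n + 2) choose 2))" for n
  proof -
    define x where "x = real n + 1"
    have x: "x > 0" by (simp add: x_def)
    have "(c * (x + 1)\<^sup>2 + b * (x + 1)) / ((x + 1) * x) = (c * (x + 1) + b) * (x + 1) / (x * (x + 1))"
      by (simp add: power2_eq_square algebra_simps)
    also have "\<dots> = (c * (x + 1) + b) / x" using x by (intro mult_divide_mult_cancel_right) auto
    also have "\<dots> = c + (c + b) * inverse x" using x by (simp add: field_simps)
    finally show ?thesis by (simp add: real_choose_two x_def add_ac)
  qed
  ultimately have "(\<lambda>n. (c * (real (n + 2))\<^sup>2 + b * real (n + 2)) / (2 * real ((n + 2) choose 2))) \<longlonglongrightarrow> c"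
    by simp
  then show ?thesis by (rule LIMSEQ_offset)
qed

lemma realizes_simple:
  assumes "realizes t w (verts H) (edges H)" "tree_size t = k" "k \<ge> 1"
  shows "simple_graph H" "edges H \<noteq> {}"
proof -
  note H = realizes_basic[OF assms(1)]
  show "simple_graph H" unfolding simple_graph_def using H by blast
  show "edges H \<noteq> {}" using H assms(2,3) by (metis card.empty not_one_le_zero)
qed

lemma pi_star_tree_le:
  assumes "realizes t w (verts H) (edges H)" "tree_size t = k" "k \<ge> 1"
  shows "pi_star k H \<le> ((real k - 1) / real k)\<^sup>2"
proof -
  define b where "b = 2 * real (card (child_subtrees t) * 2 ^ k * Suc k)"
  note H = realizes_simple[OF assms]
  have "real (ex_star k n H) / real (n choose 2)
      \<le> (((real k - 1) / real k)\<^sup>2 * (real n)\<^sup>2 + b * real n) / (2 * real (n choose 2))" for n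
  proof -
    obtain G where G: "graph_system k {1..n} G" "rainbow_free k {1..n} G H"
      "\<And>i. i \<in> {1..k} \<Longrightarrow> ex_star k n H \<le> card (edges (G i))"
      using ex_star_attained[OF H assms(3)] by blast
    obtain i where i: "i \<in> {1..k}"
      "2 * real (card (edges (G i))) \<le> ((real k - 1) / real k)\<^sup>2 * (real n)\<^sup>2 + b * real n"
      using rainbow_free_min_edges[OF _ G(1,2) assms] by (auto simp: b_def)
    have "2 * real (ex_star k n H) \<le> ((real k - 1) / real k)\<^sup>2 * (real n)\<^sup>2 + b * real n"
      using G(3)[OF i(1)] i(2) by linarith
    then have "2 * real (ex_star k n H) / (2 * real (n choose 2))
        \<le> (((real k - 1) / real k)\<^sup>2 * (real n)\<^sup>2 + b * real n) / (2 * real (n choose 2))"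
      by (rule divide_right_mono) simp
    then show ?thesis by simp
  qed
  then show ?thesis
    using LIMSEQ_le[OF ex_star_density_tendsto_pi_star[OF H assms(3)] quadratic_ratio_tendsto] by blast
qed

section \<open>The star and its extremal construction\<close>

lemma star_graph_realizes:
  obtains t where "realizes t 0 (verts (star_graph k)) (edges (star_graph k))" "tree_size t = k"
proof -
  obtain t where t: "realizes t 0 (verts (star_graph k)) (edges (star_graph k))"
    using star_realizes ..
  have "tree_size t = k" using realizes_basic[OF t] by (simp add: star_graph_def)
  then show ?thesis by (rule that[OF t])
qed

text \<open>A rainbow star with \<open>k\<close> edges uses all \<open>k\<close> colours at its
  centre \<open>w\<close>, but colour \<open>w mod k + 1\<close> has no edge at
  \<open>w\<close>.\<close>

lemma rainbow_star_free:
  assumes "k \<ge> 1"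
  shows "rainbow_free k V (\<lambda>i. (V, nsets {v \<in> V. v mod k \<noteq> i - 1} 2)) (star_graph k)"
proof (unfold rainbow_free_def, rule notI, elim exE conjE)
  fix H' assume H': "rainbow_subgraph k V (\<lambda>i. (V, nsets {v \<in> V. v mod k \<noteq> i - 1} 2)) H'"
    "graph_iso H' (star_graph k)"
  obtain \<psi> where \<psi>: "simple_graph H'" "verts H' \<subseteq> V" "inj_on \<psi> (edges H')" "\<psi> ` edges H' \<subseteq> {1..k}"
    "\<forall>e\<in>edges H'. e \<in> nsets {v \<in> V. v mod k \<noteq> \<psi> e - 1} 2"
    by (rule rainbow_subgraphE[OF H'(1), unfolded snd_conv])
  obtain t where t: "realizes t 0 (verts (star_graph k)) (edges (star_graph k))" "tree_size t = k"
    by (rule star_graph_realizes)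
  obtain f where f: "bij_betw f (verts H') (verts (star_graph k))" "edges (star_graph k) = (`) f ` edges H'"
    by (rule graph_isoE[OF H'(2) \<psi>(1) realizes_simple(1)[OF t assms]])
  have sub: "edges H' \<subseteq> Pow (verts H')" using \<psi>(1) by (auto simp: simple_graph_def nsets_def)
  have "inj_on ((`) f) (edges H')"
    using inj_on_subset[OF inj_on_image_Pow sub] f(1) by (auto simp: bij_betw_def)
  then have "card (edges H') = k"
    using realizes_basic[OF t(1)] t(2) by (simp add: f(2) card_image)
  then have "\<psi> ` edges H' = {1..k}"
    using \<psi>(3,4) by (intro card_subset_eq) (auto simp: card_image)
  moreover have "0 \<in> f ` verts H'" using f(1) by (simp add: bij_betw_def star_graph_def)
  then obtain w where w: "w \<in> verts H'" "f w = 0" by auto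
  have "w mod k + 1 \<in> {1..k}" using assms by (simp add: Suc_leI)
  ultimately obtain e where e: "e \<in> edges H'" "\<psi> e = w mod k + 1" by (metis imageE)
  have "f ` e \<in> edges (star_graph k)" using f(2) e(1) by blast
  then have "0 \<in> f ` e" by (auto simp: star_graph_def)
  then obtain x where x: "x \<in> e" "f x = 0" by auto
  have "x \<in> verts H'" using x(1) sub e(1) by auto
  then have "x = w" using x(2) w inj_onD[OF bij_betw_imp_inj_on[OF f(1)], of x w] by simp
  then have "w mod k \<noteq> \<psi> e - 1" using bspec[OF \<psi>(5) e(1)] x(1) by (auto simp: nsets_def)
  then show False using e(2) by simp
qed

lemma card_residue_class_le: "k \<ge> 1 \<Longrightarrow> card {v \<in> {1..n}. v mod k = r} \<le> n div k + 1" for k n r :: nat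
proof -
  have "card {v \<in> {1..n}. v mod k = r} = card ((\<lambda>v. v div k) ` {v \<in> {1..n}. v mod k = r})"
    by (intro card_image[symmetric] inj_onI) (metis (mono_tags, lifting) div_mult_mod_eq mem_Collect_eq)
  also have "\<dots> \<le> card {0..n div k}" by (intro card_mono) (auto simp: div_le_mono)
  finally show ?thesis by simp
qed

text \<open>A residue class has at most \<open>n div k + 1\<close> members, so each
  \<open>G i\<close> is complete on \<open>s \<ge> c * n - 1\<close> vertices. Squaring costs at
  most \<open>2 * n\<close>, and passing from \<open>s^2\<close> to \<open>s * (s - 1)\<close> at
  most \<open>n\<close>.\<close>

lemma ex_star_star_ge:
  assumes "k \<ge> 1"
  shows "((real k - 1) / real k)\<^sup>2 * (real n)\<^sup>2 + (-3) * real n \<le> 2 * real (ex_star k n (star_graph k))"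
proof -
  define c where "c = (real k - 1) / real k"
  have c: "0 \<le> c" "c \<le> 1" using assms by (auto simp: c_def)
  define G where "G i = ({1..n}, nsets {v \<in> {1..n}. v mod k \<noteq> i - 1} 2)" for i
  have sys: "graph_system k {1..n} G"
    unfolding graph_system_def simple_graph_def G_def fst_conv snd_conv
    by (intro ballI conjI nsets_mono) auto
  have free: "rainbow_free k {1..n} G (star_graph k)"
    unfolding G_def using assms by (rule rainbow_star_free)
  have dense: "c\<^sup>2 * (real n)\<^sup>2 - 3 * real n \<le> 2 * real (card (edges (G i)))" if "i \<in> {1..k}" for i
  proof -
    define s where "s = card {v \<in> {1..n}. v mod k \<noteq> i - 1}"
    have "card ({v \<in> {1..n}. v mod k \<noteq> i - 1} \<union> {v \<in> {1..n}. v mod k = i - 1})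
        \<le> s + card {v \<in> {1..n}. v mod k = i - 1}"
      unfolding s_def by (rule card_Un_le)
    also have "{v \<in> {1..n}. v mod k \<noteq> i - 1} \<union> {v \<in> {1..n}. v mod k = i - 1} = {1..n}" by auto
    finally have "n \<le> s + card {v \<in> {1..n}. v mod k = i - 1}" by simp
    also have "\<dots> \<le> s + (n div k + 1)" using card_residue_class_le[OF assms] by simp
    finally have "real n \<le> real s + real (n div k) + 1" by linarith
    also have "real (n div k) \<le> real n / real k" using of_nat_div_le_of_nat[of n k] by simp
    finally have s1: "c * real n - 1 \<le> real s"
      using assms by (simp add: c_def field_simps)
    have "s \<le> card {1..n}" unfolding s_def by (rule card_mono) auto
    then have sn: "s \<le> n" by simp
    have "c\<^sup>2 * (real n)\<^sup>2 - 2 * real n \<le> (real s)\<^sup>2"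
    \<comment> \<open>Squaring \<open>s1\<close> needs a nonnegative left side; when
      \<open>c * n \<le> 1\<close>, the claimed lower bound is at most \<open>0\<close>
      anyway.\<close>
    proof (cases "c * real n \<le> 1")
      case True
      have "(c * real n) * (c * real n) \<le> 1 * (c * real n)" using True c by (intro mult_right_mono) auto
      also have "\<dots> \<le> 1 * real n" using c mult_right_mono[of c 1 "real n"] by simp
      finally have "c\<^sup>2 * (real n)\<^sup>2 \<le> real n" by (simp add: power2_eq_square mult_ac)
      moreover have "0 \<le> real n" "0 \<le> (real s)\<^sup>2" by simp_all
      ultimately show ?thesis by linarith
    next
      case False
      then have "(c * real n - 1)\<^sup>2 \<le> (real s)\<^sup>2" using s1 by (intro power_mono) auto
      moreover have "(c * real n - 1)\<^sup>2 = c\<^sup>2 * (real n)\<^sup>2 - 2 * (c * real n) + 1"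
        by (simp add: power2_eq_square algebra_simps)
      moreover have "c * real n \<le> real n" using c mult_right_mono[of c 1 "real n"] by simp
      ultimately show ?thesis by linarith
    qed
    moreover have "2 * real (card (edges (G i))) = (real s)\<^sup>2 - real s"
      unfolding G_def snd_conv card_nsets s_def[symmetric] real_choose_two
      by (simp add: power2_eq_square right_diff_distrib)
    ultimately show ?thesis using sn by simp
  qed
  have "nat \<lceil>(c\<^sup>2 * (real n)\<^sup>2 - 3 * real n) / 2\<rceil> \<le> card (edges (G i))" if "i \<in> {1..k}" for i
    using dense[OF that] by (simp add: nat_le_iff ceiling_le_iff mult.commute)
  then have "nat \<lceil>(c\<^sup>2 * (real n)\<^sup>2 - 3 * real n) / 2\<rceil> \<le> ex_star k n (star_graph k)"
    by (rule ex_star_ge[OF sys free assms])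
  then have "(c\<^sup>2 * (real n)\<^sup>2 - 3 * real n) / 2 \<le> real (ex_star k n (star_graph k))" by linarith
  then show ?thesis by (simp add: c_def)
qed

lemma pi_star_star:
  assumes "k \<ge> 1"
  shows "pi_star k (star_graph k) = ((real k - 1) / real k)\<^sup>2"
proof (rule antisym)
  obtain t where t: "realizes t 0 (verts (star_graph k)) (edges (star_graph k))" "tree_size t = k"
    by (rule star_graph_realizes)
  show "pi_star k (star_graph k) \<le> ((real k - 1) / real k)\<^sup>2" by (rule pi_star_tree_le[OF t assms])
  have "(((real k - 1) / real k)\<^sup>2 * (real n)\<^sup>2 + (-3) * real n) / (2 * real (n choose 2))
      \<le> real (ex_star k n (star_graph k)) / real (n choose 2)" for n
    using divide_right_mono[OF ex_star_star_ge[OF assms], of "2 * real (n choose 2)" n] by simp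
  then show "((real k - 1) / real k)\<^sup>2 \<le> pi_star k (star_graph k)"
    using LIMSEQ_le[OF quadratic_ratio_tendsto
        ex_star_density_tendsto_pi_star[OF realizes_simple[OF t assms] assms]] by blast
qed

theorem theorem1p3:
  fixes T :: "'a ugraph" and k :: nat
  assumes "k \<ge> 1" and "tree T" and "card (edges T) = k"
  shows "pi_star k T \<le> pi_star k (star_graph k) \<and>
         pi_star k (star_graph k) = ((real k - 1) / real k)\<^sup>2"
proof -
  obtain t w where t: "realizes t w (verts T) (edges T)" by (rule tree_realizes[OF assms(2)])
  have "tree_size t = k" using realizes_basic[OF t] assms(3) by simp
  from pi_star_tree_le[OF t this assms(1)] show ?thesis by (simp add: pi_star_star[OF assms(1)])
qed

end
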